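(* Let $\phi$ be an integrable function on $\mathbb{R}^n$ whose radial majorant $$\psi(x)=\sup_{|y|\ge|x|}|\phi(y)|$$ is also integrable on $\mathbb{R}^n$, and for $\epsilon>0$ set $\phi_\epsilon(x)=\epsilon^{-n}\phi(x/\epsilon)$. Let $A(t)=\int_0^t a(s)\,ds$ be a Young function satisfying $\int_{\mathbb{R}_+}A\left(\frac{k}{1+t}\right)dt<\infty$ for some $k>0$, and set $\mathcal A(t)=t\int_0^t a(s)\,\frac{ds}{s}$, $t>0$ (which is a Young function). Then there is a constant $C>0$, independent of $f$, such that $$\rho_A\left(\sup_{\epsilon>0}|\phi_\epsilon*f|\right)\le C\,\rho_{\mathcal A}(f)$$ whenever $\rho_{\mathcal A}(f)<\infty$. Moreover, when $\phi$ is positive, radial and decreasing, $L_{\mathcal A}(\mathbb{R}^n)$ is the largest Orlicz space for which this bound holds; that is, if $B$ is a Young function for which there is a constant $C'>0$ with $\rho_A(\sup_{\epsilon>0}|\phi_\epsilon*f|)\le C'\rho_B(f)$ for all $f\in L_B(\mathbb{R}^n)$, then $L_B(\mathbb{R}^n)\subset L_{\mathcal A}(\mathbb{R}^n)$.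
   Context: $\mathbb{R}_+=(0,\infty)$. A Young function is a function $A(t)=\int_0^t a(s)\,ds$, $t\in\mathbb{R}_+$, where $a$ is a nondecreasing function mapping $\mathbb{R}_+$ onto itself. For a Young function $A$, the Luxemburg--Orlicz norm on $\mathbb{R}^n$ (Lebesgue measure) is $\rho_A(f)=\inf\{\lambda>0:\int_{\mathbb{R}^n}A(|f(x)|/\lambda)\,dx\le1\}$, with $\inf\emptyset=\infty$, and the Orlicz space $L_A(\mathbb{R}^n)$ consists of all measurable $f$ on $\mathbb{R}^n$ with $\rho_A(f)<\infty$. $(\phi_\epsilon*f)(x)=\int_{\mathbb{R}^n}\phi_\epsilon(x-y)f(y)\,dy$. "Radial and decreasing" means that $\phi(x)$ depends only on $|x|$ and is decreasing as a function of $|x|$. *)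

theory Defs
  imports "HOL-Analysis.Analysis"
begin

definition young_density :: "(real \<Rightarrow> real) \<Rightarrow> bool" where
  "young_density a \<longleftrightarrow> mono_on {0<..} a \<and> a ` {0<..} = {0<..}"

(* For t = 0 the integral is over the empty set, so every Young function is
   extended from (0,\<infinity>) to [0,\<infinity>) by the value 0 at 0.  Values at negative
   arguments are never used. *)
definition young_of :: "(real \<Rightarrow> real) \<Rightarrow> real \<Rightarrow> real" where
  "young_of a t = (LBINT s:{0<..t}. a s)"

definition is_young :: "(real \<Rightarrow> real) \<Rightarrow> bool" where
  "is_young A \<longleftrightarrow> (\<exists>a. young_density a \<and> (\<forall>t\<ge>0. A t = young_of a t))"

definition calA :: "(real \<Rightarrow> real) \<Rightarrow> real \<Rightarrow> real" where
  "calA a t = t * (LBINT s:{0<..t}. a s / s)"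

(* A Young function extended to [0,\<infinity>] by A(\<infinity>) = \<infinity>. *)
definition young_ext :: "(real \<Rightarrow> real) \<Rightarrow> ennreal \<Rightarrow> ennreal" where
  "young_ext A t = (if t = \<infinity> then \<infinity> else ennreal (A (enn2real t)))"

(* The Luxemburg norm is defined on functions with values in [0,\<infinity>], because a
   maximal function may be infinite at some points; for a real function f it is
   applied to |f|.  In ennreal the infimum of the empty set is \<infinity>. *)
definition luxemburg_norm :: "(real \<Rightarrow> real) \<Rightarrow> (real ^ 'n \<Rightarrow> ennreal) \<Rightarrow> ennreal" where
  "luxemburg_norm A g =
     Inf {ennreal l | l. l > 0 \<and> (\<integral>\<^sup>+ x. young_ext A (g x / ennreal l) \<partial>lebesgue) \<le> 1}"

abbreviation orlicz_norm :: "(real \<Rightarrow> real) \<Rightarrow> (real ^ 'n \<Rightarrow> real) \<Rightarrow> ennreal" where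
  "orlicz_norm A f \<equiv> luxemburg_norm A (\<lambda>x. ennreal \<bar>f x\<bar>)"

definition orlicz_space :: "(real \<Rightarrow> real) \<Rightarrow> (real ^ 'n \<Rightarrow> real) set" where
  "orlicz_space A = {f \<in> borel_measurable lebesgue. orlicz_norm A f < \<infinity>}"

(* Taken in [0,\<infinity>]: the supremum is infinite at the origin if \<phi> is unbounded near it.
   Its superlevel sets are balls (or empty or everything), so it is always Borel. *)
definition radial_majorant :: "(real ^ 'n \<Rightarrow> real) \<Rightarrow> real ^ 'n \<Rightarrow> ennreal" where
  "radial_majorant \<phi> x = (SUP y \<in> {y. norm y \<ge> norm x}. ennreal \<bar>\<phi> y\<bar>)"

definition dilate :: "(real ^ 'n \<Rightarrow> real) \<Rightarrow> real \<Rightarrow> real ^ 'n \<Rightarrow> real" where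
  "dilate \<phi> \<epsilon> x = inverse (\<epsilon> ^ CARD('n)) * \<phi> (inverse \<epsilon> *\<^sub>R x)"

definition convolve :: "(real ^ 'n \<Rightarrow> real) \<Rightarrow> (real ^ 'n \<Rightarrow> real) \<Rightarrow> real ^ 'n \<Rightarrow> real" where
  "convolve \<phi> f x = (LINT y|lebesgue. \<phi> (x - y) * f y)"

(* If \<phi> has an integrable radial majorant and f lies in an Orlicz space (hence in
   L^1 + L^\<infinity>), then for almost every x the convolution integrals converge
   absolutely for all \<epsilon> > 0 simultaneously, being dominated by a multiple of the
   Hardy-Littlewood maximal function of f.  So the value 0 that the library assigns
   to a divergent integral occurs only on a null set and does not affect the norm. *)
definition maximal_conv :: "(real ^ 'n \<Rightarrow> real) \<Rightarrow> (real ^ 'n \<Rightarrow> real) \<Rightarrow> real ^ 'n \<Rightarrow> ennreal" where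
  "maximal_conv \<phi> f x = (SUP \<epsilon> \<in> {0<..}. ennreal \<bar>convolve (dilate \<phi> \<epsilon>) f x\<bar>)"

(* Monotonicity is required only away from the origin: kernels that are unbounded near
   0 have no finite value at 0 compatible with it, and the value there is irrelevant. *)
definition radial_decreasing :: "(real ^ 'n \<Rightarrow> real) \<Rightarrow> bool" where
  "radial_decreasing \<phi> \<longleftrightarrow> (\<exists>g. antimono_on {0<..} g \<and> (\<forall>x. \<phi> x = g (norm x)))"

end

theory Submission
  imports Defs
begin

text \<open>Layer-cake integration over the superlevel sets of the radial majorant \<open>\<psi>\<close>, which are balls, gives
  \<open>sup\<^sub>\<epsilon> |\<phi>\<^sub>\<epsilon> * f| \<le> \<parallel>\<psi>\<parallel>\<^sub>1 M f\<close> pointwise, with \<open>M\<close> the Hardy-Littlewood maximal operator. Splitting \<open>f\<close> at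
  height \<open>t/2\<close> in the weak type estimate gives \<open>t |{M f > t}| \<le> C \<integral>\<^bsub>|f| > t/2\<^esub> |f|\<close>; multiplying by
  \<open>a(t)/t\<close> and integrating in \<open>t\<close> turns the right-hand side into the modular of \<open>calA a\<close> at \<open>2|f|\<close>.

  For the converse let \<open>f\<close> be \<open>h\<close> times the indicator of a ball \<open>D\<close> of radius \<open>r\<close> around 0 with \<open>|D| = 1/B(h)\<close>, so that \<open>f\<close> has norm at most 1 in
  \<open>L\<^sub>B\<close>. The maximal function dominates \<open>c h min(1, r/|x|)\<^sup>n\<close>, whose \<open>A\<close>-modular is exactly
  \<open>|D| calA a (c h)\<close>. Hence \<open>calA a (\<kappa> h) \<le> B(h)\<close> for all \<open>h > 0\<close>.\<close>

text \<open>The definitions use Bochner integrals, which take the value 0 when they diverge, so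
  \<open>calA a\<close> is meaningful only if a(s)/s is integrable near 0. This is what the
  condition on A(k/(1+t)) supplies. It is a natural condition: up to constants, k/(1+t) is the
  maximal function of the indicator of a ball, seen as a function of the volume enclosed by |x|, so
  the condition asks that this function have finite A-norm. Fubini arguments are carried out with
  nonnegative integrals; \<open>LBINT\<close> is reached from them through finiteness.

  In the direct bound the modular estimate carries the Vitali factor 5^n in front of the integral,
  whereas a norm bound needs its constant inside the argument. No doubling condition on A is
  available. Instead calA a (t/C) <= calA a t / C for C >= 1 lets 5^n be absorbed, which produces
  the norm constant 2 K 5^n, with K a bound for the mass of the majorant.

  In the converse the radius is tied to the height so that the volume of the ball is exactly what
  turns a bound by 1 on a modular into a pointwise comparison with B(h).\<close>

section \<open>Young functions as integrals over levels\<close>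

text \<open>A density is constrained on the open half-line only and is arbitrary elsewhere. Cutting
  it off at 0 gives a Borel function on the whole line, so that level integrals need no separate
  restriction at 0.\<close>

definition ennreal_on_pos :: "(real \<Rightarrow> real) \<Rightarrow> real \<Rightarrow> ennreal" where
  "ennreal_on_pos f s = ennreal (f s) * indicator {0<..} s"

lemma ennreal_on_pos_measurable:
  assumes "(\<lambda>s. indicator {0<..} s *\<^sub>R f s) \<in> borel_measurable borel"
  shows "ennreal_on_pos f \<in> borel_measurable borel"
proof -
  have "ennreal_on_pos f = (\<lambda>s. ennreal (indicator {0<..} s *\<^sub>R f s))"
    by (auto simp: ennreal_on_pos_def fun_eq_iff indicator_def)
  then show ?thesis using assms by simp
qed

text \<open>Bridge from \<open>LBINT\<close> to nonnegative integrals. The finiteness premise rules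
  out the default value 0 of a divergent Bochner integral.\<close>

lemma set_lborel_Ioc_eq_nn_integral:
  fixes f :: "real \<Rightarrow> real"
  assumes meas: "(\<lambda>s. indicator {0<..} s *\<^sub>R f s) \<in> borel_measurable borel"
    and nn: "\<And>s. s > 0 \<Longrightarrow> f s \<ge> 0"
    and fin: "(\<integral>\<^sup>+ s. ennreal_on_pos f s * indicator {..t} s \<partial>lborel) < \<infinity>"
  shows "set_integrable lborel {0<..t} f"
    and "ennreal (LBINT s:{0<..t}. f s) = (\<integral>\<^sup>+ s. ennreal_on_pos f s * indicator {..t} s \<partial>lborel)"
proof -
  have eq: "(\<lambda>s. indicator {0<..t} s *\<^sub>R f s) = (\<lambda>s. indicator {..t} s *\<^sub>R (indicator {0<..} s *\<^sub>R f s))"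
    by (auto simp: fun_eq_iff indicator_def)
  have m: "(\<lambda>s. indicator {0<..t} s *\<^sub>R f s) \<in> borel_measurable lborel"
    unfolding eq using meas by simp
  have nn': "0 \<le> indicator {0<..t} s *\<^sub>R f s" for s
    using nn[of s] by (auto simp: indicator_def)
  have e: "ennreal (indicator {0<..t} s *\<^sub>R f s) = ennreal_on_pos f s * indicator {..t} s" for s
    by (auto simp: ennreal_on_pos_def indicator_def)
  have i: "integrable lborel (\<lambda>s. indicator {0<..t} s *\<^sub>R f s)"
    by (rule integrableI_nonneg[OF m]) (use nn' fin in \<open>auto simp: e[simplified]\<close>)
  then show "set_integrable lborel {0<..t} f"
    by (simp add: set_integrable_def)
  show "ennreal (LBINT s:{0<..t}. f s) = (\<integral>\<^sup>+ s. ennreal_on_pos f s * indicator {..t} s \<partial>lborel)"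
    unfolding set_lebesgue_integral_def e[symmetric]
    by (rule nn_integral_eq_integral[symmetric, OF i]) (use nn' in auto)
qed

lemma young_densityD:
  assumes "young_density a"
  shows young_density_pos: "0 < s \<Longrightarrow> 0 < a s"
    and young_density_mono: "0 < s \<Longrightarrow> s \<le> t \<Longrightarrow> a s \<le> a t"
    and young_density_onto: "0 < y \<Longrightarrow> \<exists>t>0. a t = y"
proof -
  have "a ` {0<..} = {0<..}" and "mono_on {0<..} a"
    using assms by (auto simp: young_density_def)
  then show "0 < s \<Longrightarrow> 0 < a s" and "0 < s \<Longrightarrow> s \<le> t \<Longrightarrow> a s \<le> a t"
    by (auto simp: mono_on_def)
  show "0 < y \<Longrightarrow> \<exists>t>0. a t = y"
    using \<open>a ` {0<..} = {0<..}\<close> by (metis (no_types, lifting) greaterThan_iff imageE)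
qed

lemma young_density_scaled_measurable:
  assumes "young_density a"
  shows "(\<lambda>s. indicator {0<..} s *\<^sub>R a s) \<in> borel_measurable borel"
proof -
  have "a \<in> borel_measurable (restrict_space borel {0<..})"
    using assms by (intro borel_measurable_mono_on_fnc) (simp add: young_density_def)
  then show ?thesis by (simp add: borel_measurable_restrict_space_iff)
qed

lemma young_density_measurable:
  assumes "young_density a"
  shows "ennreal_on_pos a \<in> borel_measurable borel"
  by (rule ennreal_on_pos_measurable[OF young_density_scaled_measurable[OF assms]])

lemma young_of_nn_integral:
  assumes a: "young_density a"
  shows "ennreal (young_of a t) = (\<integral>\<^sup>+ s. ennreal_on_pos a s * indicator {..t} s \<partial>lborel)"
  unfolding young_of_def
proof (rule set_lborel_Ioc_eq_nn_integral)
  have "(\<integral>\<^sup>+ s. ennreal_on_pos a s * indicator {..t} s \<partial>lborel)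
      \<le> (\<integral>\<^sup>+ s. ennreal (a t) * indicator {0<..t} s \<partial>lborel)"
    by (rule nn_integral_mono)
       (auto simp: ennreal_on_pos_def indicator_def intro!: ennreal_leI young_density_mono[OF a])
  also have "\<dots> < \<infinity>"
    by (cases "0 \<le> t") (auto simp: nn_integral_cmult ennreal_mult_less_top)
  finally show "(\<integral>\<^sup>+ s. ennreal_on_pos a s * indicator {..t} s \<partial>lborel) < \<infinity>" .
qed (use young_density_scaled_measurable[OF a] young_density_pos[OF a] in \<open>auto intro: less_imp_le\<close>)

lemma young_of_nonneg:
  assumes "young_density a"
  shows "0 \<le> young_of a t"
  unfolding young_of_def set_lebesgue_integral_def
  by (rule integral_nonneg_AE) (use young_density_pos[OF assms] in \<open>auto simp: indicator_def intro!: less_imp_le\<close>)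

lemma young_of_0 [simp]: "young_of a 0 = 0"
  by (simp add: young_of_def set_lebesgue_integral_def)

text \<open>The set \<open>{s. ennreal s < u}\<close> is the form that Fubini turns into a
  superlevel set in \<open>layer_cake\<close>. Negative s belong to it when u > 0 but are removed by
  \<open>ennreal_on_pos\<close>, and for finite u the endpoint is a null set.\<close>

lemma young_ext_eq_nn_integral:
  assumes a: "young_density a" and A: "\<And>t. t \<ge> 0 \<Longrightarrow> A t = young_of a t"
  shows "young_ext A u = (\<integral>\<^sup>+ s. ennreal_on_pos a s * indicator {s. ennreal s < u} s \<partial>lborel)"
proof (cases u rule: ennreal_cases)
  case (real t)
  then have "young_ext A u = ennreal (young_of a t)"
    by (simp add: young_ext_def A)
  also have "\<dots> = (\<integral>\<^sup>+ s. ennreal_on_pos a s * indicator {..t} s \<partial>lborel)"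
    by (rule young_of_nn_integral[OF a])
  also have "\<dots> = (\<integral>\<^sup>+ s. ennreal_on_pos a s * indicator {s. ennreal s < u} s \<partial>lborel)"
    by (intro nn_integral_cong_AE eventually_mono[OF AE_lborel_singleton[of t]])
       (use real in \<open>auto simp: ennreal_on_pos_def indicator_def ennreal_less_iff not_le not_less\<close>)
  finally show ?thesis .
next
  \<comment> \<open>The convention for A at infinity agrees with the integral: \<open>a\<close> is
    onto and nondecreasing, hence at least 1 on a half-line, which has infinite measure.\<close>
  case top
  obtain t where t: "t > 0" "a t = 1"
    using young_density_onto[OF a, of 1] by auto
  have "emeasure lborel {t..} = \<infinity>"
  proof (rule ccontr)
    assume "emeasure lborel {t..} \<noteq> \<infinity>"
    then obtain r where r: "r \<ge> 0" "emeasure lborel {t..} = ennreal r"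
      by (cases "emeasure lborel {t..}") auto
    have "emeasure lborel {t..t + (r + 1)} \<le> emeasure lborel {t..}"
      by (rule emeasure_mono) auto
    then show False using r by simp
  qed
  then have "\<infinity> = (\<integral>\<^sup>+ s. indicator {t..} s \<partial>lborel)"
    by simp
  also have "\<dots> \<le> (\<integral>\<^sup>+ s. ennreal_on_pos a s * indicator {s. ennreal s < u} s \<partial>lborel)"
    using t young_density_mono[OF a t(1)] top
    by (intro nn_integral_mono) (auto simp: ennreal_on_pos_def indicator_def)
  finally show ?thesis using top by (simp add: young_ext_def top_unique)
qed

lemma young_ext_mono:
  assumes "young_density a" "\<And>t. t \<ge> 0 \<Longrightarrow> A t = young_of a t" "u \<le> v"
  shows "young_ext A u \<le> young_ext A v"
  by (subst (1 2) young_ext_eq_nn_integral[of a A])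
     (use assms in \<open>auto simp: indicator_def intro!: nn_integral_mono intro: less_le_trans\<close>)

text \<open>Fubini, exchanging the level t for the point x. The weight W is 1 when a distribution
  function is wanted; W = F in \<open>radial_convolution_le_hl_max\<close> and W = 2F in
  \<open>hl_max_modular_le\<close> give integrals over superlevel sets.\<close>

lemma layer_cake:
  fixes G W :: "'a \<Rightarrow> ennreal" and \<alpha> :: "real \<Rightarrow> ennreal"
  assumes "sigma_finite_measure M"
    and [measurable]: "\<alpha> \<in> borel_measurable borel" "G \<in> borel_measurable M" "W \<in> borel_measurable M"
  shows "(\<integral>\<^sup>+ x. (\<integral>\<^sup>+ t. \<alpha> t * indicator {t. ennreal t < G x} t \<partial>lborel) * W x \<partial>M) =
         (\<integral>\<^sup>+ t. \<alpha> t * (\<integral>\<^sup>+ x. W x * indicator {x. ennreal t < G x} x \<partial>M) \<partial>lborel)"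
proof -
  interpret M: sigma_finite_measure M by fact
  interpret pair_sigma_finite lborel M ..
  have *: "\<alpha> t * indicator {t. ennreal t < G x} t * W x = \<alpha> t * (W x * indicator {x. ennreal t < G x} x)" for t x
    by (auto simp: indicator_def)
  have "(\<integral>\<^sup>+ x. (\<integral>\<^sup>+ t. \<alpha> t * indicator {t. ennreal t < G x} t \<partial>lborel) * W x \<partial>M) =
        (\<integral>\<^sup>+ x. (\<integral>\<^sup>+ t. \<alpha> t * (W x * indicator {x. ennreal t < G x} x) \<partial>lborel) \<partial>M)"
    by (simp add: nn_integral_multc[symmetric] *)
  also have "\<dots> = (\<integral>\<^sup>+ t. (\<integral>\<^sup>+ x. \<alpha> t * (W x * indicator {x. ennreal t < G x} x) \<partial>M) \<partial>lborel)"
    by (rule Fubini') (simp add: indicator_def)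
  also have "\<dots> = (\<integral>\<^sup>+ t. \<alpha> t * (\<integral>\<^sup>+ x. W x * indicator {x. ennreal t < G x} x \<partial>M) \<partial>lborel)"
    by (simp add: nn_integral_cmult)
  finally show ?thesis .
qed

section \<open>Integrability of a(s)/s near 0\<close>

lemma over_id_scaled_measurable:
  assumes "young_density a"
  shows "(\<lambda>s. indicator {0<..} s *\<^sub>R (a s / s)) \<in> borel_measurable borel"
proof -
  have "(\<lambda>s. (indicator {0<..} s *\<^sub>R a s) / s) \<in> borel_measurable borel"
    using young_density_scaled_measurable[OF assms] by measurable
  then show ?thesis by simp
qed

text \<open>By Fubini \<open>\<integral>A(k/(1+t))dt = \<integral>a(s)(k/s - 1)\<^sup>+ds\<close>, and \<open>k/s - 1 \<ge> k/(2s)\<close> for \<open>s \<le> k/2\<close>.\<close>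

lemma young_density_over_id_integrable:
  assumes a: "young_density a" and A: "\<And>t. t \<ge> 0 \<Longrightarrow> A t = young_of a t"
    and A_int: "\<exists>k>0. (\<integral>\<^sup>+ t\<in>{0<..}. ennreal (A (k / (1 + t))) \<partial>lborel) < \<infinity>"
  shows "(\<integral>\<^sup>+ s. ennreal_on_pos (\<lambda>s. a s / s) s * indicator {..t} s \<partial>lborel) < \<infinity>"
proof -
  note [measurable] = young_density_measurable[OF a]
  obtain k where k: "k > 0" and fin: "(\<integral>\<^sup>+ t\<in>{0<..}. ennreal (A (k / (1 + t))) \<partial>lborel) < \<infinity>"
    using A_int by auto
  have meas: "ennreal_on_pos (\<lambda>s. a s / s) \<in> borel_measurable borel"
    by (rule ennreal_on_pos_measurable[OF over_id_scaled_measurable[OF a]])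
  have Aeq: "ennreal (A (k / (1 + t))) * indicator {0<..} t
      = (\<integral>\<^sup>+ s. ennreal_on_pos a s * indicator {s. s \<le> k / (1 + t)} s \<partial>lborel) * indicator {0<..} t" for t
  proof (cases "t > 0")
    case True
    then have "A (k / (1 + t)) = young_of a (k / (1 + t))"
      using k by (intro A) simp
    then show ?thesis by (simp add: young_of_nn_integral[OF a] atMost_def)
  qed simp
  have "(\<integral>\<^sup>+ t. ennreal (A (k / (1 + t))) * indicator {0<..} t \<partial>lborel)
      = (\<integral>\<^sup>+ t. (\<integral>\<^sup>+ s. ennreal_on_pos a s * (indicator {s. s \<le> k / (1 + t)} s * indicator {0<..} t) \<partial>lborel) \<partial>lborel)"
    unfolding Aeq by (simp add: nn_integral_multc[symmetric] mult.assoc)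
  also have "\<dots> = (\<integral>\<^sup>+ s. (\<integral>\<^sup>+ t. ennreal_on_pos a s * (indicator {s. s \<le> k / (1 + t)} s * indicator {0<..} t) \<partial>lborel) \<partial>lborel)"
    by (rule lborel_pair.Fubini'[symmetric]) (simp add: indicator_def)
  also have "\<dots> \<ge> (\<integral>\<^sup>+ s. ennreal (k/2) * (ennreal_on_pos (\<lambda>s. a s / s) s * indicator {..k/2} s) \<partial>lborel)"
  proof (rule nn_integral_mono)
    fix s :: real
    show "ennreal (k/2) * (ennreal_on_pos (\<lambda>s. a s / s) s * indicator {..k/2} s)
      \<le> (\<integral>\<^sup>+ t. ennreal_on_pos a s * (indicator {s. s \<le> k / (1 + t)} s * indicator {0<..} t) \<partial>lborel)"
    proof (cases "0 < s \<and> s \<le> k / 2")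
      case True
      then have s: "0 < s" "s \<le> k/2" by auto
      have "ennreal (k/2) * (ennreal_on_pos (\<lambda>s. a s / s) s * indicator {..k/2} s) = ennreal (a s) * ennreal (k / 2 / s)"
        using s k young_density_pos[OF a s(1)]
        by (simp add: ennreal_on_pos_def ennreal_mult'[symmetric] mult.commute)
      also have "\<dots> \<le> ennreal (a s) * ennreal (k / s - 1)"
        using s by (intro mult_left_mono ennreal_leI) (auto simp: field_simps)
      also have "ennreal (k / s - 1) = (\<integral>\<^sup>+ t. indicator {0<..k / s - 1} t \<partial>lborel)"
        using s by (simp add: field_simps)
      also have "\<dots> = (\<integral>\<^sup>+ t. indicator {s. s \<le> k / (1 + t)} s * indicator {0<..} t \<partial>lborel)"
        using s by (intro nn_integral_cong) (auto simp: indicator_def field_simps)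
      also have "ennreal (a s) * \<dots> = (\<integral>\<^sup>+ t. ennreal_on_pos a s * (indicator {s. s \<le> k / (1 + t)} s * indicator {0<..} t) \<partial>lborel)"
        using s by (subst nn_integral_cmult) (auto simp: ennreal_on_pos_def indicator_def)
      finally show ?thesis .
    qed (auto simp: ennreal_on_pos_def indicator_def)
  qed
  finally have "(\<integral>\<^sup>+ s. ennreal (k/2) * (ennreal_on_pos (\<lambda>s. a s / s) s * indicator {..k/2} s) \<partial>lborel) < \<infinity>"
    using fin by (rule le_less_trans)
  then have 1: "(\<integral>\<^sup>+ s. ennreal_on_pos (\<lambda>s. a s / s) s * indicator {..k/2} s \<partial>lborel) < \<infinity>"
    using k meas by (auto simp: nn_integral_cmult ennreal_mult_less_top)
  have "(\<integral>\<^sup>+ s. ennreal_on_pos (\<lambda>s. a s / s) s * indicator {..t} s \<partial>lborel)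
     \<le> (\<integral>\<^sup>+ s. ennreal_on_pos (\<lambda>s. a s / s) s * indicator {..k/2} s + ennreal (a t / (k/2)) * indicator {k/2<..max t (k/2)} s \<partial>lborel)"
  proof (rule nn_integral_mono)
    fix s :: real
    \<comment> \<open>The hypothesis controls the integral up to k/2 only; beyond that, monotonicity
      of \<open>a\<close> bounds the integrand on the rest of (0, t]. The \<open>max\<close> keeps
      the second interval well formed when t < k/2.\<close>
    have "a s / s \<le> a t / (k/2)" if "k/2 < s" "s \<le> t"
      using that k young_density_mono[OF a, of s t] young_density_pos[OF a, of s] by (intro frac_le) auto
    then show "ennreal_on_pos (\<lambda>s. a s / s) s * indicator {..t} s \<le> ennreal_on_pos (\<lambda>s. a s / s) s * indicator {..k/2} s
        + ennreal (a t / (k/2)) * indicator {k/2<..max t (k/2)} s"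
      using k by (cases "s \<le> k/2"; cases "s \<le> t") (auto simp: ennreal_on_pos_def indicator_def intro!: ennreal_leI)
  qed
  also have "\<dots> < \<infinity>"
    using 1 meas by (subst nn_integral_add) (auto simp: nn_integral_cmult ennreal_mult_less_top)
  finally show ?thesis .
qed

section \<open>\<open>calA a\<close> as a Young function\<close>

context
  fixes a :: "real \<Rightarrow> real"
  assumes a: "young_density a"
    and fin: "\<And>t. (\<integral>\<^sup>+ s. ennreal_on_pos (\<lambda>s. a s / s) s * indicator {..t} s \<partial>lborel) < \<infinity>"
begin

lemma over_id_integrable: "set_integrable lborel {0<..t} (\<lambda>s. a s / s)"
  and over_id_nn_integral: "ennreal (LBINT s:{0<..t}. a s / s)
    = (\<integral>\<^sup>+ s. ennreal_on_pos (\<lambda>s. a s / s) s * indicator {..t} s \<partial>lborel)"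
  using set_lborel_Ioc_eq_nn_integral[OF over_id_scaled_measurable[OF a] _ fin]
    young_density_pos[OF a] by (auto simp: less_imp_le)

lemma over_id_LBINT_nonneg: "0 \<le> (LBINT s:{0<..t}. a s / s)"
  unfolding set_lebesgue_integral_def
  by (rule integral_nonneg_AE) (use young_density_pos[OF a] in \<open>auto simp: indicator_def intro!: divide_nonneg_nonneg less_imp_le\<close>)

lemma over_id_LBINT_mono: "t \<le> u \<Longrightarrow> (LBINT s:{0<..t}. a s / s) \<le> (LBINT s:{0<..u}. a s / s)"
  by (subst ennreal_le_iff[symmetric, OF over_id_LBINT_nonneg])
     (auto simp: over_id_nn_integral indicator_def intro!: nn_integral_mono)

lemma calA_nn_integral:
  "t \<ge> 0 \<Longrightarrow> ennreal (calA a t) = ennreal t * (\<integral>\<^sup>+ s. ennreal_on_pos (\<lambda>s. a s / s) s * indicator {..t} s \<partial>lborel)"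
  by (simp add: calA_def ennreal_mult over_id_LBINT_nonneg over_id_nn_integral)

text \<open>calA a t / t is the integral of a(s)/s up to t and so nondecreasing in t. This is what
  later moves the factor 5^n from in front of the modular into the argument.\<close>

lemma calA_le_scale:
  assumes "t \<ge> 0" "C \<ge> 1"
  shows "calA a (t / C) \<le> calA a t / C"
proof -
  have "(LBINT s:{0<..t/C}. a s / s) \<le> (LBINT s:{0<..t}. a s / s)"
    using assms by (intro over_id_LBINT_mono) (simp add: divide_le_eq mult_left_le_one_le mult_le_cancel_left1)
  then have "t / C * (LBINT s:{0<..t/C}. a s / s) \<le> t / C * (LBINT s:{0<..t}. a s / s)"
    using assms by (intro mult_left_mono) auto
  then show ?thesis by (simp add: calA_def)
qed

lemma calA_nonneg: "t \<ge> 0 \<Longrightarrow> 0 \<le> calA a t"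
  by (simp add: calA_def over_id_LBINT_nonneg)

text \<open>The interval includes 0, where the integral vanishes; this yields the limit at 0 that
  surjectivity of the new density requires.\<close>

lemma over_id_LBINT_continuous: "continuous_on {0..T} (\<lambda>t. LBINT s:{0<..t}. a s / s)"
proof -
  define g where "g = (\<lambda>s. indicator {0<..} s *\<^sub>R (a s / s))"
  have si: "set_integrable lborel {0..t} g"
    and eq: "(LBINT s:{0<..t}. a s / s) = (LBINT s:{0..t}. g s)" for t
  proof -
    have *: "(\<lambda>s. indicator {0<..t} s *\<^sub>R (a s / s)) = (\<lambda>s. indicator {0..t} s *\<^sub>R g s)"
      by (auto simp: g_def fun_eq_iff split: split_indicator)
    show "set_integrable lborel {0..t} g"
      using over_id_integrable[of t] unfolding set_integrable_def * .
    show "(LBINT s:{0<..t}. a s / s) = (LBINT s:{0..t}. g s)"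
      unfolding set_lebesgue_integral_def * ..
  qed
  show ?thesis
    unfolding eq set_borel_integral_eq_integral(2)[OF si]
    by (rule indefinite_integral_continuous_1[OF set_borel_integral_eq_integral(1)[OF si]])
qed

text \<open>A jump of a monotone function would leave a gap in its image, but the image is the whole
  open half-line.\<close>

lemma young_density_continuous: "continuous_on {0<..} a"
  by (rule continuous_onI_mono) (use a in \<open>auto simp: young_density_def mono_on_def\<close>)

text \<open>The density is what the product rule gives for the derivative of t times the integral of
  a(s)/s. Surjectivity follows from the intermediate value theorem.\<close>

lemma young_density_calA: "young_density (\<lambda>t. (LBINT s:{0<..t}. a s / s) + a t)"
  (is "young_density ?b")
proof -
  have mono: "mono_on {0<..} ?b"
    using young_density_mono[OF a] over_id_LBINT_mono by (intro mono_onI add_mono) auto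
  have pos: "?b t > 0" if "t > 0" for t
    using over_id_LBINT_nonneg[of t] young_density_pos[OF a that] by simp
  have "\<exists>t>0. ?b t = y" if y: "y > 0" for y
  proof -
    obtain t1 where t1: "t1 > 0" "a t1 = y" using young_density_onto[OF a y] by auto
    obtain t2 where t2: "t2 > 0" "a t2 = y/2" using young_density_onto[OF a, of "y/2"] y by auto
    have "((\<lambda>t. LBINT s:{0<..t}. a s / s) \<longlongrightarrow> (LBINT s:{0<..0}. a s / s)) (at 0 within {0..1})"
      using over_id_LBINT_continuous[of 1] unfolding continuous_on_def by (elim bspec) simp
    then have "((\<lambda>t. LBINT s:{0<..t}. a s / s) \<longlongrightarrow> 0) (at_right 0)"
      by (simp add: at_within_Icc_at_right set_lebesgue_integral_def)
    then have "eventually (\<lambda>t. (LBINT s:{0<..t}. a s / s) < y/2) (at_right 0)"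
      by (rule order_tendstoD) (use y in simp)
    then obtain d where d: "d > 0" "\<And>t. 0 < t \<Longrightarrow> t < d \<Longrightarrow> (LBINT s:{0<..t}. a s / s) < y/2"
      by (auto simp: eventually_at_right_field)
    \<comment> \<open>At \<open>t0\<close> each of the two summands of the density is at most y/2;
      at \<open>t1\<close> the summand \<open>a t1\<close> alone already equals y.\<close>
    define t0 where "t0 = min (min t1 t2) (d/2)"
    have t0: "t0 > 0" "t0 \<le> t1" "t0 \<le> t2" "t0 < d" using t1 t2 d by (auto simp: t0_def)
    have "?b t0 \<le> y"
      using d(2)[OF t0(1) t0(4)] young_density_mono[OF a t0(1) t0(3)] t2 by simp
    moreover have "y \<le> ?b t1" using over_id_LBINT_nonneg[of t1] t1 by simp
    moreover have "continuous_on {t0..t1} ?b"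
      using t0 by (intro continuous_intros continuous_on_subset[OF over_id_LBINT_continuous[of t1]]
        continuous_on_subset[OF young_density_continuous]) auto
    ultimately obtain x where "t0 \<le> x" "x \<le> t1" "?b x = y"
      using IVT'[of ?b t0 y t1] t0 by auto
    then show ?thesis using t0 by (intro exI[of _ x]) auto
  qed
  then show ?thesis
    using mono pos by (auto simp: young_density_def image_iff)
qed

text \<open>No differentiation is involved: by Fubini the first summand of the density integrates to
  the integral of (a(s)/s)(t - s) over (0, t], and (a(s)/s)(t - s) + a(s) = t a(s)/s.\<close>

lemma calA_eq_young_of:
  assumes t: "t \<ge> 0"
  shows "calA a t = young_of (\<lambda>t. (LBINT s:{0<..t}. a s / s) + a t) t"
proof -
  let ?F = "ennreal_on_pos (\<lambda>s. a s / s)"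
  note [measurable] = young_density_measurable[OF a] ennreal_on_pos_measurable[OF over_id_scaled_measurable[OF a]]
  have "ennreal (young_of (\<lambda>t. (LBINT s:{0<..t}. a s / s) + a t) t)
     = (\<integral>\<^sup>+ r. ennreal_on_pos (\<lambda>t. (LBINT s:{0<..t}. a s / s) + a t) r * indicator {..t} r \<partial>lborel)"
    by (rule young_of_nn_integral[OF young_density_calA])
  also have "\<dots> = (\<integral>\<^sup>+ r. (\<integral>\<^sup>+ s. ?F s * (indicator {s. s \<le> r} s * indicator {0<..t} r) \<partial>lborel)
      + ennreal_on_pos a r * indicator {..t} r \<partial>lborel)"
  proof (rule nn_integral_cong)
    fix r :: real
    show "ennreal_on_pos (\<lambda>t. (LBINT s:{0<..t}. a s / s) + a t) r * indicator {..t} r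
      = (\<integral>\<^sup>+ s. ?F s * (indicator {s. s \<le> r} s * indicator {0<..t} r) \<partial>lborel)
         + ennreal_on_pos a r * indicator {..t} r"
    proof (cases "0 < r \<and> r \<le> t")
      case True
      then show ?thesis
        using young_density_pos[OF a, of r] over_id_LBINT_nonneg[of r] over_id_nn_integral[of r]
        by (auto simp: ennreal_on_pos_def ennreal_plus atMost_def less_imp_le)
    qed (auto simp: ennreal_on_pos_def indicator_def)
  qed
  also have "\<dots> = (\<integral>\<^sup>+ r. (\<integral>\<^sup>+ s. ?F s * (indicator {s. s \<le> r} s * indicator {0<..t} r) \<partial>lborel) \<partial>lborel)
      + (\<integral>\<^sup>+ r. ennreal_on_pos a r * indicator {..t} r \<partial>lborel)"
    by (rule nn_integral_add) (simp_all add: indicator_def)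
  also have "(\<integral>\<^sup>+ r. (\<integral>\<^sup>+ s. ?F s * (indicator {s. s \<le> r} s * indicator {0<..t} r) \<partial>lborel) \<partial>lborel)
      = (\<integral>\<^sup>+ s. (\<integral>\<^sup>+ r. ?F s * (indicator {s. s \<le> r} s * indicator {0<..t} r) \<partial>lborel) \<partial>lborel)"
    by (rule lborel_pair.Fubini'[symmetric]) (simp add: indicator_def)
  also have "\<dots> + (\<integral>\<^sup>+ r. ennreal_on_pos a r * indicator {..t} r \<partial>lborel)
      = (\<integral>\<^sup>+ s. (\<integral>\<^sup>+ r. ?F s * (indicator {s. s \<le> r} s * indicator {0<..t} r) \<partial>lborel)
          + ennreal_on_pos a s * indicator {..t} s \<partial>lborel)"
    by (rule nn_integral_add[symmetric]) (simp_all add: indicator_def)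
  also have "\<dots> = (\<integral>\<^sup>+ s. ennreal t * (?F s * indicator {..t} s) \<partial>lborel)"
  proof (rule nn_integral_cong)
    fix s :: real
    show "(\<integral>\<^sup>+ r. ?F s * (indicator {s. s \<le> r} s * indicator {0<..t} r) \<partial>lborel)
          + ennreal_on_pos a s * indicator {..t} s = ennreal t * (?F s * indicator {..t} s)"
    proof (cases "0 < s \<and> s \<le> t")
      case True
      have "(\<integral>\<^sup>+ r. ?F s * (indicator {s. s \<le> r} s * indicator {0<..t} r) \<partial>lborel)
         = (\<integral>\<^sup>+ r. ennreal (a s / s) * indicator {s..t} r \<partial>lborel)"
        using True by (intro nn_integral_cong) (auto simp: ennreal_on_pos_def indicator_def)
      also have "\<dots> = ennreal (a s / s * (t - s))"
        using True young_density_pos[OF a, of s]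
        by (simp add: nn_integral_cmult ennreal_mult[symmetric] del: times_divide_eq_left)
      finally show ?thesis
        using True young_density_pos[OF a, of s]
        by (simp add: ennreal_on_pos_def ennreal_mult[symmetric] ennreal_plus[symmetric] del: ennreal_plus)
           (simp add: field_simps)
    next
      case False
      then have "(\<integral>\<^sup>+ r. ?F s * (indicator {s. s \<le> r} s * indicator {0<..t} r) \<partial>lborel) = (\<integral>\<^sup>+ (r::real). 0 \<partial>lborel)"
        by (intro nn_integral_cong) (auto simp: ennreal_on_pos_def indicator_def)
      then show ?thesis using False by (auto simp: ennreal_on_pos_def indicator_def)
    qed
  qed
  also have "\<dots> = ennreal (calA a t)"
    using t by (simp add: calA_nn_integral nn_integral_cmult)
  finally show ?thesis
    using t by (simp add: calA_nonneg young_of_nonneg[OF young_density_calA])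
qed

end

section \<open>The Hardy-Littlewood maximal function and its weak type estimate\<close>

lemma radius_pos_if_in_ball: "x \<in> ball c r \<Longrightarrow> 0 < r"
  by (rule ccontr) (simp add: ball_empty)

lemma less_divide_ennreal:
  "b \<noteq> 0 \<Longrightarrow> b < top \<Longrightarrow> c < a / b \<longleftrightarrow> c * b < (a :: ennreal)"
  by (cases a; cases b; cases c)
     (auto simp: divide_ennreal ennreal_mult[symmetric] ennreal_less_iff field_simps ennreal_top_mult ennreal_top_divide ennreal_mult_less_top)

lemma emeasure_lebesgue_ball:
  "r \<ge> 0 \<Longrightarrow> emeasure lebesgue (ball (c::'a::euclidean_space) r) = ennreal (unit_ball_vol (DIM('a)) * r ^ DIM('a))"
  by (simp add: emeasure_ball)

lemma emeasure_lebesgue_ball_pos: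
  "r > 0 \<Longrightarrow> emeasure lebesgue (ball (c::'a::euclidean_space) r) \<noteq> 0"
  by (simp add: emeasure_lebesgue_ball ennreal_eq_0_iff not_le del: emeasure_completion)

lemma emeasure_lebesgue_ball_finite: "emeasure lebesgue (ball (c::'a::euclidean_space) r) < \<infinity>"
  by (cases "r \<ge> 0") (simp_all add: emeasure_lebesgue_ball ball_empty del: emeasure_completion)

lemma emeasure_lebesgue_ball_scale:
  assumes "r \<ge> 0" "k \<ge> 0"
  shows "emeasure lebesgue (ball (c::'a::euclidean_space) (k * r)) = ennreal (k ^ DIM('a)) * emeasure lebesgue (ball (d::'a) r)"
  using assms by (simp add: emeasure_lebesgue_ball ennreal_mult[symmetric] power_mult_distrib ac_simps del: emeasure_completion)

text \<open>With uncentred balls the superlevel sets of the maximal function are open, whatever \<open>F\<close> is.\<close>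

definition hl_max :: "('a::euclidean_space \<Rightarrow> ennreal) \<Rightarrow> 'a \<Rightarrow> ennreal" where
  "hl_max F x = (SUP (c, r) \<in> {(c, r). x \<in> ball c r}.
     (\<integral>\<^sup>+ y\<in>ball c r. F y \<partial>lebesgue) / emeasure lebesgue (ball c r))"

lemma hl_max_upper:
  assumes "x \<in> ball c r"
  shows "(\<integral>\<^sup>+ y\<in>ball c r. F y \<partial>lebesgue) \<le> hl_max F x * emeasure lebesgue (ball c r)"
proof -
  have "r > 0" by (rule radius_pos_if_in_ball[OF assms])
  have "(\<integral>\<^sup>+ y\<in>ball c r. F y \<partial>lebesgue) / emeasure lebesgue (ball c r) \<le> hl_max F x"
    unfolding hl_max_def using assms by (intro SUP_upper2[of "(c, r)"]) auto
  then show ?thesis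
    using emeasure_lebesgue_ball_pos[OF \<open>r > 0\<close>, of c] emeasure_lebesgue_ball_finite[of c r]
    by (simp add: not_less[symmetric] less_divide_ennreal del: emeasure_completion)
qed

lemma less_hl_max_iff:
  "t < hl_max F x \<longleftrightarrow>
    (\<exists>c r. x \<in> ball c r \<and> t < (\<integral>\<^sup>+ y\<in>ball c r. F y \<partial>lebesgue) / emeasure lebesgue (ball c r))"
  by (auto simp: hl_max_def less_SUP_iff)

lemma open_hl_max_superlevel: "open {x. t < hl_max F x}"
proof -
  define Q where "Q c r \<longleftrightarrow> t < (\<integral>\<^sup>+ y\<in>ball c r. F y \<partial>lebesgue) / emeasure lebesgue (ball c r)" for c r
  have "{x. t < hl_max F x} = (\<Union>(c, r) \<in> {(c, r). Q c r}. ball c r)"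
    unfolding less_hl_max_iff Q_def[symmetric] by blast
  also have "open \<dots>" by auto
  finally show ?thesis .
qed

lemma hl_max_measurable [measurable]: "hl_max F \<in> borel_measurable borel"
  by (rule borel_measurableI_greater) (simp add: open_hl_max_superlevel)

lemma hl_max_bounded:
  assumes "\<And>y. F y \<le> ennreal h"
  shows "hl_max F x \<le> ennreal h"
  unfolding hl_max_def
proof (rule SUP_least, clarify)
  fix c :: 'a and r :: real
  assume "x \<in> ball c r"
  then have r: "r > 0" by (rule radius_pos_if_in_ball)
  have "(\<integral>\<^sup>+ y\<in>ball c r. F y \<partial>lebesgue) \<le> (\<integral>\<^sup>+ y. ennreal h * indicator (ball c r) y \<partial>lebesgue)"
    by (intro nn_integral_mono mult_right_mono assms) auto
  also have "\<dots> = emeasure lebesgue (ball c r) * ennreal h"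
    by (subst nn_integral_cmult_indicator) (auto simp: mult.commute)
  finally show "(\<integral>\<^sup>+ y\<in>ball c r. F y \<partial>lebesgue) / emeasure lebesgue (ball c r) \<le> ennreal h"
    using emeasure_lebesgue_ball_pos[OF r, of c]
    by (intro divide_le_posI_ennreal) (simp_all add: zero_less_iff_neq_zero del: emeasure_completion)
qed

text \<open>Pointwise F is at most t plus its part above height t, and the average of the constant t
  is t. The weak type estimate can then be applied to the high part alone, since F itself may have
  infinite integral.\<close>

lemma hl_max_split:
  fixes F :: "'a::euclidean_space \<Rightarrow> ennreal"
  assumes [measurable]: "F \<in> borel_measurable lebesgue"
  shows "hl_max F x \<le> t + hl_max (\<lambda>y. F y * indicator {y. t < F y} y) x"
  unfolding hl_max_def[of F]
proof (rule SUP_least, clarify)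
  fix c :: 'a and r :: real
  assume x: "x \<in> ball c r"
  let ?B = "ball c r" and ?H = "\<lambda>y. F y * indicator {y. t < F y} y"
  have r: "r > 0" by (rule radius_pos_if_in_ball[OF x])
  have [measurable]: "?B \<in> sets lebesgue" by simp
  have "{y \<in> space lebesgue. t < F y} \<in> sets lebesgue" by measurable
  then have [measurable]: "{y. t < F y} \<in> sets lebesgue" by simp
  have "(\<integral>\<^sup>+ y\<in>?B. F y \<partial>lebesgue) \<le> (\<integral>\<^sup>+ y. t * indicator ?B y + ?H y * indicator ?B y \<partial>lebesgue)"
    by (rule nn_integral_mono) (auto simp: indicator_def not_less)
  also have "\<dots> = t * emeasure lebesgue ?B + (\<integral>\<^sup>+ y\<in>?B. ?H y \<partial>lebesgue)"
    by (subst nn_integral_add) (measurable, simp add: nn_integral_cmult_indicator)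
  also have "\<dots> \<le> t * emeasure lebesgue ?B + hl_max ?H x * emeasure lebesgue ?B"
    by (intro add_left_mono hl_max_upper x)
  also have "\<dots> = emeasure lebesgue ?B * (t + hl_max ?H x)"
    by (simp add: algebra_simps del: emeasure_completion)
  finally show "(\<integral>\<^sup>+ y\<in>?B. F y \<partial>lebesgue) / emeasure lebesgue ?B \<le> t + hl_max ?H x"
    using emeasure_lebesgue_ball_pos[OF r, of c] 
    by (intro divide_le_posI_ennreal) (simp_all add: zero_less_iff_neq_zero del: emeasure_completion)
qed

text \<open>Vitali covering: balls on which the average exceeds t cover the superlevel set, a
  disjoint subfamily covers it after fivefold enlargement, and disjointness keeps the sum of the
  integrals below the integral of F. The factor 5^n is the volume ratio.\<close>

lemma hl_max_weak_type:
  fixes F :: "'a::euclidean_space \<Rightarrow> ennreal"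
  assumes [measurable]: "F \<in> borel_measurable lebesgue" and t: "t > 0"
  shows "ennreal t * emeasure lebesgue {x. ennreal t < hl_max F x} \<le> 5 ^ DIM('a) * (\<integral>\<^sup>+ y. F y \<partial>lebesgue)"
proof (cases "(\<integral>\<^sup>+ y. F y \<partial>lebesgue)" rule: ennreal_cases)
  case top
  then show ?thesis by (simp add: ennreal_mult_top)
next
  case (real X)
  let ?V = "unit_ball_vol (real DIM('a))"
  define K where "K = {(c::'a, r). r > 0 \<and> ennreal t < (\<integral>\<^sup>+ y\<in>ball c r. F y \<partial>lebesgue) / emeasure lebesgue (ball c r)}"
  have K: "ennreal t * emeasure lebesgue (ball c r) \<le> (\<integral>\<^sup>+ y\<in>ball c r. F y \<partial>lebesgue)"
    and Kpos: "r > 0" if "(c, r) \<in> K" for c r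
  proof -
    show "r > 0" using that by (simp add: K_def)
    show "ennreal t * emeasure lebesgue (ball c r) \<le> (\<integral>\<^sup>+ y\<in>ball c r. F y \<partial>lebesgue)"
      using that emeasure_lebesgue_ball_pos[OF \<open>r > 0\<close>, of c] emeasure_lebesgue_ball_finite[of c r]
      by (simp add: K_def less_divide_ennreal less_imp_le del: emeasure_completion)
  qed
  \<comment> \<open>The covering lemma needs a common bound on the radii. It comes from t |B| <= X;
    radii up to 1 are covered by the \<open>max\<close>, and for larger ones r <= r^n avoids an n-th
    root.\<close>
  have Kb: "snd i \<le> max 1 (X / (t * ?V))" if i: "i \<in> K" for i
  proof (cases "snd i \<le> 1")
    case False
    obtain c r where cr: "i = (c, r)" by (cases i)
    have "ennreal (t * (?V * r ^ DIM('a))) = ennreal t * emeasure lebesgue (ball c r)"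
      using False cr t by (simp add: emeasure_lebesgue_ball ennreal_mult del: emeasure_completion)
    also have "\<dots> \<le> (\<integral>\<^sup>+ y\<in>ball c r. F y \<partial>lebesgue)"
      using K i cr by blast
    also have "\<dots> \<le> (\<integral>\<^sup>+ y. F y \<partial>lebesgue)"
      by (rule nn_integral_mono) (auto simp: indicator_def)
    finally have "t * (?V * r ^ DIM('a)) \<le> X" using real by simp
    moreover have "r \<le> r ^ DIM('a)"
      using False cr by (intro self_le_power) auto
    then have "t * (?V * r) \<le> t * (?V * r ^ DIM('a))"
      using t by (intro mult_left_mono) (auto intro: less_imp_le)
    ultimately have "r * (t * ?V) \<le> X" by (simp add: algebra_simps)
    then have "r \<le> X / (t * ?V)"
      using t by (subst pos_le_divide_eq) auto
    then show ?thesis using cr by simp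
  qed simp
  have Kpos': "snd i > 0" if "i \<in> K" for i
    using that by (auto simp: K_def)
  have cover: "{x. ennreal t < hl_max F x} \<subseteq> (\<Union>i\<in>K. ball (fst i) (snd i))"
  proof
    fix x assume "x \<in> {x. ennreal t < hl_max F x}"
    then obtain c r where "x \<in> ball c r" "ennreal t < (\<integral>\<^sup>+ y\<in>ball c r. F y \<partial>lebesgue) / emeasure lebesgue (ball c r)"
      by (auto simp only: less_hl_max_iff mem_Collect_eq)
    moreover from this(1) have "r > 0" by (rule radius_pos_if_in_ball)
    ultimately have "(c, r) \<in> K" by (simp add: K_def)
    then show "x \<in> (\<Union>i\<in>K. ball (fst i) (snd i))" using \<open>x \<in> ball c r\<close> by force
  qed
  obtain C where C: "countable C" "C \<subseteq> K"
     "pairwise (\<lambda>i j. disjnt (ball (fst i) (snd i)) (ball (fst j) (snd j))) C"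
     "{x. ennreal t < hl_max F x} \<subseteq> (\<Union>i\<in>C. ball (fst i) (5 * snd i))"
    by (rule Vitali_covering_lemma_balls[OF cover, of "max 1 (X / (t * ?V))"]) (intro conjI Kpos' Kb)
  define D where "D k n = (if n \<in> to_nat_on C ` C
     then ball (fst (from_nat_into C n)) (k * snd (from_nat_into C n)) else {})" for k n
  have D_empty: "D k n = {}" if "n \<notin> to_nat_on C ` C" for k n using that by (simp add: D_def)
  have D_ball: "D k (to_nat_on C i) = ball (fst i) (k * snd i)" if "i \<in> C" for k i
    using that C(1) by (simp add: D_def)
  have D_sets [measurable]: "D k n \<in> sets lebesgue" for k n by (simp add: D_def)
  have disj: "disjoint_family (D 1)"
    unfolding disjoint_family_on_def
  proof (intro ballI impI)
    fix m n :: nat assume "m \<noteq> n"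
    show "D 1 m \<inter> D 1 n = {}"
    proof (cases "m \<in> to_nat_on C ` C \<and> n \<in> to_nat_on C ` C")
      case True
      then obtain i j where ij: "i \<in> C" "j \<in> C" "m = to_nat_on C i" "n = to_nat_on C j" by auto
      then have "i \<noteq> j" using \<open>m \<noteq> n\<close> by auto
      have "disjnt (ball (fst i) (snd i)) (ball (fst j) (snd j))"
        by (rule pairwiseD[OF C(3) ij(1,2) \<open>i \<noteq> j\<close>])
      then show ?thesis using ij by (simp only: D_ball disjnt_def mult_1)
    next
      case False
      then have "D 1 m = {} \<or> D 1 n = {}" using D_empty by blast
      then show ?thesis by blast
    qed
  qed
  have "emeasure lebesgue {x. ennreal t < hl_max F x} \<le> emeasure lebesgue (\<Union>n. D 5 n)"
  proof (rule emeasure_mono)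
    show "{x. ennreal t < hl_max F x} \<subseteq> (\<Union>n. D 5 n)"
    proof
      fix x assume "x \<in> {x. ennreal t < hl_max F x}"
      then obtain i where "i \<in> C" "x \<in> ball (fst i) (5 * snd i)" using C(4) by blast
      then have "x \<in> D 5 (to_nat_on C i)" by (simp only: D_ball)
      then show "x \<in> (\<Union>n. D 5 n)" by blast
    qed
    show "(\<Union>n. D 5 n) \<in> sets lebesgue" by measurable
  qed
  also have "\<dots> \<le> (\<Sum>n. emeasure lebesgue (D 5 n))"
    by (rule emeasure_subadditive_countably) auto
  finally have "ennreal t * emeasure lebesgue {x. ennreal t < hl_max F x}
     \<le> ennreal t * (\<Sum>n. emeasure lebesgue (D 5 n))"
    by (rule mult_left_mono) simp
  also have "\<dots> = (\<Sum>n. ennreal t * emeasure lebesgue (D 5 n))"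
    by simp
  also have "\<dots> \<le> (\<Sum>n. 5 ^ DIM('a) * (\<integral>\<^sup>+ y\<in>D 1 n. F y \<partial>lebesgue))"
  proof (intro suminf_le summableI)
    fix n
    show "ennreal t * emeasure lebesgue (D 5 n) \<le> 5 ^ DIM('a) * (\<integral>\<^sup>+ y\<in>D 1 n. F y \<partial>lebesgue)"
    proof (cases "n \<in> to_nat_on C ` C")
      case True
      then obtain i where i: "i \<in> C" "n = to_nat_on C i" by auto
      then have iK: "(fst i, snd i) \<in> K" using C(2) by auto
      have "ennreal t * emeasure lebesgue (D 5 n) = 5 ^ DIM('a) * (ennreal t * emeasure lebesgue (ball (fst i) (snd i)))"
        using i Kpos[OF iK] emeasure_lebesgue_ball_scale[of "snd i" 5 "fst i" "fst i"]
        by (simp add: D_ball ennreal_power[symmetric] mult_ac del: emeasure_completion)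
      also have "\<dots> \<le> 5 ^ DIM('a) * (\<integral>\<^sup>+ y\<in>ball (fst i) (snd i). F y \<partial>lebesgue)"
        by (intro mult_left_mono K iK) simp
      finally show ?thesis using i by (simp add: D_ball)
    qed (simp add: D_empty)
  qed
  also have "\<dots> = 5 ^ DIM('a) * (\<integral>\<^sup>+ y\<in>(\<Union>n. D 1 n). F y \<partial>lebesgue)"
    by (subst nn_integral_disjoint_family[OF _ _ disj]) auto
  also have "\<dots> \<le> 5 ^ DIM('a) * (\<integral>\<^sup>+ y. F y \<partial>lebesgue)"
    by (intro mult_left_mono nn_integral_mono) (auto simp: indicator_def)
  finally show ?thesis .
qed

section \<open>Radially decreasing kernels are controlled by the maximal function\<close>

lemma sigma_finite_lebesgue: "sigma_finite_measure (lebesgue :: 'a::euclidean_space measure)"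
proof
  obtain S :: "'a set set" where S: "countable S" "S \<subseteq> sets lborel" "\<Union>S = space lborel" "\<forall>s\<in>S. emeasure lborel s \<noteq> \<infinity>"
    using lborel.sigma_finite_countable by auto
  then show "\<exists>S. countable S \<and> S \<subseteq> sets lebesgue \<and> \<Union>S = space lebesgue \<and> (\<forall>s\<in>S. emeasure (lebesgue :: 'a measure) s \<noteq> \<infinity>)"
    by (intro exI[of _ S]) auto
qed

text \<open>Layer-cake formula with constant density 1. It is no instance of
  \<open>young_ext_eq_nn_integral\<close>, because a constant is not onto the half-line.\<close>

lemma ennreal_eq_nn_integral_levels:
  "u = (\<integral>\<^sup>+ t. indicator {0<..} t * indicator {t. ennreal t < u} t \<partial>lborel)"
proof (cases u rule: ennreal_cases)
  case (real r)
  have "(\<integral>\<^sup>+ t. indicator {0<..} t * indicator {t. ennreal t < u} t \<partial>lborel) = (\<integral>\<^sup>+ t. indicator {0<..<r} t \<partial>lborel)"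
    using real by (intro nn_integral_cong) (auto simp: indicator_def ennreal_less_iff)
  then show ?thesis using real by simp
next
  case top
  have "ennreal (real n) \<le> (\<integral>\<^sup>+ t. indicator {0<..} t * indicator {t. ennreal t < u} t \<partial>lborel)" for n
  proof -
    have "ennreal (real n) = (\<integral>\<^sup>+ t. indicator {0<..real n} t \<partial>lborel)" by simp
    also have "\<dots> \<le> (\<integral>\<^sup>+ t. indicator {0<..} t * indicator {t. ennreal t < u} t \<partial>lborel)"
      using top by (intro nn_integral_mono) (auto simp: indicator_def)
    finally show ?thesis .
  qed
  then have "(SUP n. of_nat n :: ennreal) \<le> (\<integral>\<^sup>+ t. indicator {0<..} t * indicator {t. ennreal t < u} t \<partial>lborel)"
    by (intro SUP_least) (simp only: ennreal_of_nat_eq_real_of_nat)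
  then show ?thesis
    unfolding top ennreal_SUP_of_nat_eq_top top_unique by (rule sym)
qed

text \<open>The superlevel set is closed under passing to points of smaller or equal norm, so it is
  determined by the supremum R of its norms and by whether R is attained. Both kinds of ball occur,
  as no semicontinuity is assumed.\<close>

lemma norm_antimono_superlevel_cases:
  fixes \<Psi> :: "'a::real_normed_vector \<Rightarrow> ennreal"
  assumes anti: "\<And>x y. norm x \<le> norm y \<Longrightarrow> \<Psi> y \<le> \<Psi> x"
  shows "{x. u < \<Psi> x} = UNIV \<or> (\<exists>R\<ge>0. {x. u < \<Psi> x} = ball 0 R \<or> {x. u < \<Psi> x} = cball 0 R)"
proof -
  define E where "E = {x. u < \<Psi> x}"
  have down: "y \<in> E" if "x \<in> E" "norm y \<le> norm x" for x y
    using that(1) anti[OF that(2)] unfolding E_def mem_Collect_eq by (rule less_le_trans)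
  consider "E = {}" | "E \<noteq> {}" "bdd_above (norm ` E)" | "\<not> bdd_above (norm ` E)" by metis
  then have "E = UNIV \<or> (\<exists>R\<ge>0. E = ball 0 R \<or> E = cball 0 R)"
  proof cases
    case 1
    \<comment> \<open>The empty set counts as the open ball of radius 0.\<close>
    then show ?thesis by (intro disjI2 exI[of _ 0]) simp
  next
    case 2
    define R where "R = Sup (norm ` E)"
    have up: "norm x \<le> R" if "x \<in> E" for x
      unfolding R_def using that 2 by (intro cSup_upper) auto
    obtain x0 where "x0 \<in> E" using 2(1) by blast
    then have R: "R \<ge> 0" using up[of x0] norm_ge_zero[of x0] by linarith
    have lo: "x \<in> E" if "norm x < R" for x
    proof -
      have "\<exists>s\<in>norm ` E. norm x < s"
        using that 2 less_cSup_iff[of "norm ` E" "norm x"] unfolding R_def by simp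
      then obtain z where "z \<in> E" "norm x < norm z" by blast
      then show ?thesis using down[of z x] by simp
    qed
    show ?thesis
    proof (cases "\<exists>z\<in>E. norm z = R")
      case True
      then obtain z where z: "z \<in> E" "norm z = R" by blast
      have "E = cball 0 R"
      proof (rule set_eqI)
        fix x show "x \<in> E \<longleftrightarrow> x \<in> cball 0 R"
          using up[of x] down[OF z(1), of x] z(2) by (simp only: mem_cball_0) blast
      qed
      then show ?thesis using R by blast
    next
      case False
      have "E = ball 0 R"
      proof (rule set_eqI)
        fix x show "x \<in> E \<longleftrightarrow> x \<in> ball 0 R"
        proof
          assume x: "x \<in> E"
          then have "norm x \<noteq> R" using False by blast
          then show "x \<in> ball 0 R" using up[OF x] by simp
        qed (use lo[of x] in simp)
      qed
      then show ?thesis using R by blast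
    qed
  next
    case 3
    have "x \<in> E" for x
    proof -
      obtain z where "z \<in> E" "norm x < norm z"
        using 3 bdd_above.I2[of E norm "norm x"] by (metis not_le)
      then show ?thesis using down[of z x] by simp
    qed
    then show ?thesis by blast
  qed
  then show ?thesis by (simp only: E_def)
qed

lemma norm_antimono_measurable:
  fixes \<Psi> :: "'a::euclidean_space \<Rightarrow> ennreal"
  assumes anti: "\<And>x y. norm x \<le> norm y \<Longrightarrow> \<Psi> y \<le> \<Psi> x"
  shows "\<Psi> \<in> borel_measurable borel"
proof (rule borel_measurableI_greater)
  fix u
  show "{x \<in> space borel. u < \<Psi> x} \<in> sets borel"
    using norm_antimono_superlevel_cases[of \<Psi> u, OF anti] by auto
qed

lemma nn_integral_cball_eq_ball:
  "(\<integral>\<^sup>+ y\<in>cball c r. F y \<partial>lebesgue) = (\<integral>\<^sup>+ y\<in>ball c r. F y \<partial>lebesgue)"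
proof (rule nn_integral_null_delta)
  have "(cball c r - ball c r) \<union> (ball c r - cball c r) = sphere c r" by auto
  then show "(cball c r - ball c r) \<union> (ball c r - cball c r) \<in> null_sets lebesgue"
    using negligible_sphere[of c r] by (simp add: negligible_iff_null_sets)
qed auto

text \<open>The superlevel sets of the dilated kernel are balls around \<open>x\<close>, on each of which the
  average of \<open>F\<close> is at most \<open>hl_max F x\<close>; integrating over the levels gives the kernel's mass.\<close>

lemma radial_convolution_le_hl_max:
  fixes \<Psi> F :: "'a::euclidean_space \<Rightarrow> ennreal"
  assumes anti: "\<And>x y. norm x \<le> norm y \<Longrightarrow> \<Psi> y \<le> \<Psi> x"
    and fin: "(\<integral>\<^sup>+ x. \<Psi> x \<partial>lebesgue) < \<infinity>"
    and F [measurable]: "F \<in> borel_measurable lebesgue"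
    and \<epsilon>: "\<epsilon> > 0"
  shows "(\<integral>\<^sup>+ y. ennreal (inverse (\<epsilon> ^ DIM('a))) * \<Psi> (inverse \<epsilon> *\<^sub>R (x - y)) * F y \<partial>lebesgue)
    \<le> (\<integral>\<^sup>+ x. \<Psi> x \<partial>lebesgue) * hl_max F x"
proof -
  define \<alpha> :: "real \<Rightarrow> ennreal" where "\<alpha> = indicator {0<..}"
  have [measurable]: "\<alpha> \<in> borel_measurable borel" by (simp add: \<alpha>_def)
  have \<Psi>b [measurable]: "\<Psi> \<in> borel_measurable borel"
    by (rule norm_antimono_measurable) (rule anti)
  have \<Psi>l [measurable]: "\<Psi> \<in> borel_measurable lebesgue"
    using \<Psi>b by (intro measurable_completion) simp
  have "(\<lambda>y. \<Psi> (inverse \<epsilon> *\<^sub>R (x - y))) \<in> borel_measurable lborel" by measurable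
  then have G [measurable]: "(\<lambda>y. \<Psi> (inverse \<epsilon> *\<^sub>R (x - y))) \<in> borel_measurable lebesgue"
    by (rule measurable_completion)
  have layer: "\<Psi> z = (\<integral>\<^sup>+ t. \<alpha> t * indicator {t. ennreal t < \<Psi> z} t \<partial>lborel)" for z
    unfolding \<alpha>_def by (rule ennreal_eq_nn_integral_levels)
  have mass: "(\<integral>\<^sup>+ x. \<Psi> x \<partial>lebesgue) = (\<integral>\<^sup>+ t. \<alpha> t * emeasure lebesgue {x. ennreal t < \<Psi> x} \<partial>lborel)"
  proof -
    have "{x \<in> space lebesgue. ennreal t < \<Psi> x} \<in> sets lebesgue" for t by measurable
    then have *: "{x. ennreal t < \<Psi> x} \<in> sets lebesgue" for t by simp
    have "(\<integral>\<^sup>+ x. \<Psi> x \<partial>lebesgue) = (\<integral>\<^sup>+ x. (\<integral>\<^sup>+ t. \<alpha> t * indicator {t. ennreal t < \<Psi> x} t \<partial>lborel) * 1 \<partial>lebesgue)"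
      by (simp only: layer[symmetric] mult_1_right)
    also have "\<dots> = (\<integral>\<^sup>+ t. \<alpha> t * (\<integral>\<^sup>+ x. 1 * indicator {x. ennreal t < \<Psi> x} x \<partial>lebesgue) \<partial>lborel)"
      by (rule layer_cake[OF sigma_finite_lebesgue]) auto
    finally show ?thesis using * by (simp del: emeasure_completion nn_integral_completion)
  qed
  have level: "(\<integral>\<^sup>+ y. F y * indicator {y. ennreal t < \<Psi> (inverse \<epsilon> *\<^sub>R (x - y))} y \<partial>lebesgue)
      \<le> ennreal (\<epsilon> ^ DIM('a)) * emeasure lebesgue {x. ennreal t < \<Psi> x} * hl_max F x" if t: "t > 0" for t
  proof -
    \<comment> \<open>Integrability excludes the whole space: otherwise the kernel would exceed the
      positive constant t on a set of infinite measure.\<close>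
    have nU: "{x. ennreal t < \<Psi> x} \<noteq> UNIV"
    proof
      assume U: "{x. ennreal t < \<Psi> x} = UNIV"
      have "(\<integral>\<^sup>+ x. ennreal t \<partial>(lebesgue :: 'a measure)) \<le> (\<integral>\<^sup>+ x. \<Psi> x \<partial>lebesgue)"
        using U by (intro nn_integral_mono) (auto intro: less_imp_le)
      then show False using fin t by (simp add: ennreal_mult_top top_unique del: nn_integral_completion)
    qed
    have ineq: "(\<integral>\<^sup>+ y\<in>ball x (\<epsilon> * R). F y \<partial>lebesgue) \<le> ennreal (\<epsilon> ^ DIM('a)) * emeasure lebesgue (ball (0::'a) R) * hl_max F x"
      if "R \<ge> 0" for R
    \<comment> \<open>For R = 0 the ball is empty and does not contain x, so
      \<open>hl_max_upper\<close> does not apply; both sides involving the ball vanish.\<close>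
    proof (cases "R = 0")
      case False
      then have "(\<integral>\<^sup>+ y\<in>ball x (\<epsilon> * R). F y \<partial>lebesgue) \<le> hl_max F x * emeasure lebesgue (ball x (\<epsilon> * R))"
        using \<epsilon> that by (intro hl_max_upper) simp
      also have "\<dots> = ennreal (\<epsilon> ^ DIM('a)) * emeasure lebesgue (ball (0::'a) R) * hl_max F x"
        using \<epsilon> that by (subst emeasure_lebesgue_ball_scale[where d = 0]) (simp_all add: ac_simps del: emeasure_completion)
      finally show ?thesis .
    qed simp
    have sc: "norm (inverse \<epsilon> *\<^sub>R (x - y)) = dist x y / \<epsilon>" for y
      using \<epsilon> by (simp add: dist_norm divide_inverse del: scaleR_diff_right)
    obtain R where R: "R \<ge> 0" "{x. ennreal t < \<Psi> x} = ball 0 R \<or> {x. ennreal t < \<Psi> x} = cball 0 R"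
      using norm_antimono_superlevel_cases[of \<Psi> "ennreal t", OF anti] nU by blast
    then show ?thesis
    proof (elim disjE)
      assume E: "{x. ennreal t < \<Psi> x} = ball 0 R"
      have "{y. ennreal t < \<Psi> (inverse \<epsilon> *\<^sub>R (x - y))} = {y. inverse \<epsilon> *\<^sub>R (x - y) \<in> ball 0 R}"
        unfolding E[symmetric] by simp
      also have "\<dots> = ball x (\<epsilon> * R)"
        using \<epsilon> by (auto simp only: mem_ball_0 sc mem_ball[where x = x] pos_divide_less_eq mem_Collect_eq mult.commute[of R])
      finally show ?thesis using ineq[OF R(1)] by (simp only: E)
    next
      assume E: "{x. ennreal t < \<Psi> x} = cball 0 R"
      have "{y. ennreal t < \<Psi> (inverse \<epsilon> *\<^sub>R (x - y))} = {y. inverse \<epsilon> *\<^sub>R (x - y) \<in> cball 0 R}"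
        unfolding E[symmetric] by simp
      also have "\<dots> = cball x (\<epsilon> * R)"
        using \<epsilon> by (auto simp only: mem_cball_0 sc mem_cball[where x = x] pos_divide_le_eq mem_Collect_eq mult.commute[of R])
      finally have eq: "{y. ennreal t < \<Psi> (inverse \<epsilon> *\<^sub>R (x - y))} = cball x (\<epsilon> * R)" .
      have "emeasure lebesgue (ball (0::'a) R) \<le> emeasure lebesgue (cball (0::'a) R)"
        by (rule emeasure_mono) auto
      then show ?thesis
        unfolding eq E nn_integral_cball_eq_ball
        by (intro order_trans[OF ineq[OF R(1)]] mult_left_mono mult_right_mono) auto
    qed
  qed
  have "(\<integral>\<^sup>+ y. \<Psi> (inverse \<epsilon> *\<^sub>R (x - y)) * F y \<partial>lebesgue)
    = (\<integral>\<^sup>+ y. (\<integral>\<^sup>+ t. \<alpha> t * indicator {t. ennreal t < \<Psi> (inverse \<epsilon> *\<^sub>R (x - y))} t \<partial>lborel) * F y \<partial>lebesgue)"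
    by (simp only: layer[symmetric])
  also have "\<dots> = (\<integral>\<^sup>+ t. \<alpha> t * (\<integral>\<^sup>+ y. F y * indicator {y. ennreal t < \<Psi> (inverse \<epsilon> *\<^sub>R (x - y))} y \<partial>lebesgue) \<partial>lborel)"
    by (rule layer_cake[OF sigma_finite_lebesgue]) auto
  also have "\<dots> \<le> (\<integral>\<^sup>+ t. (ennreal (\<epsilon> ^ DIM('a)) * hl_max F x) * (\<alpha> t * emeasure lebesgue {x. ennreal t < \<Psi> x}) \<partial>lborel)"
  proof (rule nn_integral_mono)
    fix t :: real
    show "\<alpha> t * (\<integral>\<^sup>+ y. F y * indicator {y. ennreal t < \<Psi> (inverse \<epsilon> *\<^sub>R (x - y))} y \<partial>lebesgue)
      \<le> (ennreal (\<epsilon> ^ DIM('a)) * hl_max F x) * (\<alpha> t * emeasure lebesgue {x. ennreal t < \<Psi> x})"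
      using level[of t]
      by (cases "t > 0") (simp_all add: \<alpha>_def ac_simps del: emeasure_completion nn_integral_completion)
  qed
  also have "\<dots> = (ennreal (\<epsilon> ^ DIM('a)) * hl_max F x) * (\<integral>\<^sup>+ x. \<Psi> x \<partial>lebesgue)"
    unfolding mass
  proof (rule nn_integral_cmult)
    \<comment> \<open>Measurability of the distribution function in t is obtained from
      \<open>lborel\<close>, which agrees with \<open>lebesgue\<close> on these Borel superlevel
      sets.\<close>
    have "(\<lambda>t. emeasure lebesgue {x. ennreal t < \<Psi> x}) = (\<lambda>t. emeasure lborel {x \<in> space lborel. ennreal t < \<Psi> x})"
      using \<Psi>b by (auto simp: fun_eq_iff intro!: emeasure_completion)
    also have "\<dots> \<in> borel_measurable borel"
      by measurable
    finally show "(\<lambda>t. \<alpha> t * emeasure lebesgue {x. ennreal t < \<Psi> x}) \<in> borel_measurable lborel"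
      by simp
  qed
  finally have "ennreal (inverse (\<epsilon> ^ DIM('a))) * (\<integral>\<^sup>+ y. \<Psi> (inverse \<epsilon> *\<^sub>R (x - y)) * F y \<partial>lebesgue)
    \<le> ennreal (inverse (\<epsilon> ^ DIM('a))) * ((ennreal (\<epsilon> ^ DIM('a)) * hl_max F x) * (\<integral>\<^sup>+ x. \<Psi> x \<partial>lebesgue))"
    by (rule mult_left_mono) simp
  also have "\<dots> = (ennreal (inverse (\<epsilon> ^ DIM('a))) * ennreal (\<epsilon> ^ DIM('a))) * ((\<integral>\<^sup>+ x. \<Psi> x \<partial>lebesgue) * hl_max F x)"
    by (simp only: ac_simps)
  also have "ennreal (inverse (\<epsilon> ^ DIM('a))) * ennreal (\<epsilon> ^ DIM('a)) = 1"
    using \<epsilon> by (simp add: ennreal_mult[symmetric])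
  finally show ?thesis
    by (simp add: nn_integral_cmult mult.assoc del: nn_integral_completion)
qed

lemma hl_max_cmult:
  fixes F :: "'a::euclidean_space \<Rightarrow> ennreal"
  assumes [measurable]: "F \<in> borel_measurable lebesgue"
  shows "k * hl_max F x = hl_max (\<lambda>y. k * F y) x"
proof -
  have "k * ((\<integral>\<^sup>+ y\<in>ball c r. F y \<partial>lebesgue) / emeasure lebesgue (ball c r))
      = (\<integral>\<^sup>+ y\<in>ball c r. k * F y \<partial>lebesgue) / emeasure lebesgue (ball c r)" for c and r :: real
  proof -
    have [measurable]: "ball c r \<in> sets lebesgue" by simp
    have "(\<integral>\<^sup>+ y\<in>ball c r. k * F y \<partial>lebesgue) = k * (\<integral>\<^sup>+ y\<in>ball c r. F y \<partial>lebesgue)"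
      unfolding mult.assoc by (rule nn_integral_cmult) measurable
    then show ?thesis by (simp only: ennreal_times_divide)
  qed
  then show ?thesis
    unfolding hl_max_def SUP_mult_left_ennreal by (intro SUP_cong refl) (simp only: case_prod_beta)
qed

lemma radial_majorant_antimono: "norm x \<le> norm y \<Longrightarrow> radial_majorant \<phi> y \<le> radial_majorant \<phi> x"
  unfolding radial_majorant_def by (rule SUP_subset_mono) auto

lemma radial_majorant_ge: "ennreal \<bar>\<phi> x\<bar> \<le> radial_majorant \<phi> x"
  unfolding radial_majorant_def by (rule SUP_upper) simp

text \<open>The absolute value stands inside the integral, so that the bound also proves
  integrability wherever its right side is finite; \<open>maximal_conv_ball_ge\<close> uses it in
  this way.\<close>

lemma nn_integral_dilate_le_hl_max:
  fixes \<phi> f :: "real ^ 'n \<Rightarrow> real"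
  assumes psi: "(\<integral>\<^sup>+ x. radial_majorant \<phi> x \<partial>lebesgue) < \<infinity>"
    and f [measurable]: "f \<in> borel_measurable lebesgue" and \<epsilon>: "\<epsilon> > 0"
  shows "(\<integral>\<^sup>+ y. ennreal \<bar>dilate \<phi> \<epsilon> (x - y) * f y\<bar> \<partial>lebesgue)
    \<le> (\<integral>\<^sup>+ x. radial_majorant \<phi> x \<partial>lebesgue) * hl_max (\<lambda>y. ennreal \<bar>f y\<bar>) x"
proof -
  have "(\<integral>\<^sup>+ y. ennreal \<bar>dilate \<phi> \<epsilon> (x - y) * f y\<bar> \<partial>lebesgue)
    \<le> (\<integral>\<^sup>+ y. ennreal (inverse (\<epsilon> ^ DIM(real ^ 'n))) * radial_majorant \<phi> (inverse \<epsilon> *\<^sub>R (x - y)) * ennreal \<bar>f y\<bar> \<partial>lebesgue)"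
  proof (rule nn_integral_mono)
    fix y
    have "ennreal \<bar>dilate \<phi> \<epsilon> (x - y) * f y\<bar>
      = ennreal (inverse (\<epsilon> ^ DIM(real ^ 'n))) * ennreal \<bar>\<phi> (inverse \<epsilon> *\<^sub>R (x - y))\<bar> * ennreal \<bar>f y\<bar>"
      using \<epsilon> by (simp add: dilate_def abs_mult ennreal_mult del: scaleR_diff_right)
    also have "\<dots> \<le> ennreal (inverse (\<epsilon> ^ DIM(real ^ 'n))) * radial_majorant \<phi> (inverse \<epsilon> *\<^sub>R (x - y)) * ennreal \<bar>f y\<bar>"
      by (intro mult_right_mono mult_left_mono radial_majorant_ge) auto
    finally show "ennreal \<bar>dilate \<phi> \<epsilon> (x - y) * f y\<bar> \<le> \<dots>" .
  qed
  also have "\<dots> \<le> (\<integral>\<^sup>+ x. radial_majorant \<phi> x \<partial>lebesgue) * hl_max (\<lambda>y. ennreal \<bar>f y\<bar>) x"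
    by (rule radial_convolution_le_hl_max[OF radial_majorant_antimono psi _ \<epsilon>]) auto
  finally show ?thesis .
qed

lemma maximal_conv_le_hl_max:
  fixes \<phi> f :: "real ^ 'n \<Rightarrow> real"
  assumes psi: "(\<integral>\<^sup>+ x. radial_majorant \<phi> x \<partial>lebesgue) < \<infinity>"
    and f: "f \<in> borel_measurable lebesgue"
  shows "maximal_conv \<phi> f x \<le> (\<integral>\<^sup>+ x. radial_majorant \<phi> x \<partial>lebesgue) * hl_max (\<lambda>y. ennreal \<bar>f y\<bar>) x"
  unfolding maximal_conv_def
proof (rule SUP_least)
  fix \<epsilon> :: real assume "\<epsilon> \<in> {0<..}"
  then have \<epsilon>: "\<epsilon> > 0" by simp
  have "ennreal \<bar>convolve (dilate \<phi> \<epsilon>) f x\<bar> \<le> (\<integral>\<^sup>+ y. ennreal \<bar>dilate \<phi> \<epsilon> (x - y) * f y\<bar> \<partial>lebesgue)"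
  proof (cases "integrable lebesgue (\<lambda>y. dilate \<phi> \<epsilon> (x - y) * f y)")
    case True
    from integral_norm_bound_ennreal[OF this] show ?thesis
      by (simp add: convolve_def del: nn_integral_completion)
  next
    \<comment> \<open>A divergent convolution integral has the default value 0, which satisfies the
      bound.\<close>
    case False
    then show ?thesis by (simp add: convolve_def not_integrable_integral_eq)
  qed
  also note nn_integral_dilate_le_hl_max[OF psi f \<epsilon>]
  finally show "ennreal \<bar>convolve (dilate \<phi> \<epsilon>) f x\<bar>
    \<le> (\<integral>\<^sup>+ x. radial_majorant \<phi> x \<partial>lebesgue) * hl_max (\<lambda>y. ennreal \<bar>f y\<bar>) x" .
qed

section \<open>From the weak type estimate to the norm inequality\<close>

lemma young_ext_nn_integral:
  fixes G :: "'a::euclidean_space \<Rightarrow> ennreal"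
  assumes a: "young_density a" and A: "\<And>t. t \<ge> 0 \<Longrightarrow> A t = young_of a t"
    and G [measurable]: "G \<in> borel_measurable lebesgue"
  shows "(\<integral>\<^sup>+ x. young_ext A (G x) \<partial>lebesgue)
    = (\<integral>\<^sup>+ t. ennreal_on_pos a t * emeasure lebesgue {x. ennreal t < G x} \<partial>lborel)"
proof -
  have "{x \<in> space lebesgue. ennreal t < G x} \<in> sets lebesgue" for t by measurable
  then have *: "{x. ennreal t < G x} \<in> sets lebesgue" for t by simp
  have "(\<integral>\<^sup>+ x. young_ext A (G x) \<partial>lebesgue)
    = (\<integral>\<^sup>+ x. (\<integral>\<^sup>+ t. ennreal_on_pos a t * indicator {t. ennreal t < G x} t \<partial>lborel) * 1 \<partial>lebesgue)"
    by (simp only: mult_1_right young_ext_eq_nn_integral[of a A, OF a A])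
  also have "\<dots> = (\<integral>\<^sup>+ t. ennreal_on_pos a t * (\<integral>\<^sup>+ x. 1 * indicator {x. ennreal t < G x} x \<partial>lebesgue) \<partial>lborel)"
    by (rule layer_cake[OF sigma_finite_lebesgue young_density_measurable[OF a] G]) simp
  finally show ?thesis using * by (simp del: emeasure_completion nn_integral_completion)
qed

lemma hl_max_modular_le:
  fixes f :: "'a::euclidean_space \<Rightarrow> real"
  assumes a: "young_density a" and A: "\<And>t. t \<ge> 0 \<Longrightarrow> A t = young_of a t"
    and fin: "\<And>t. (\<integral>\<^sup>+ s. ennreal_on_pos (\<lambda>s. a s / s) s * indicator {..t} s \<partial>lborel) < \<infinity>"
    and f [measurable]: "f \<in> borel_measurable lebesgue" and f0: "\<And>x. f x \<ge> 0"
  shows "(\<integral>\<^sup>+ x. young_ext A (hl_max (\<lambda>y. ennreal (f y)) x) \<partial>lebesgue)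
     \<le> 5 ^ DIM('a) * (\<integral>\<^sup>+ x. ennreal (calA a (2 * f x)) \<partial>lebesgue)"
proof -
  let ?F = "\<lambda>y. ennreal (f y)" and ?J = "ennreal_on_pos (\<lambda>s. a s / s)"
  have J [measurable]: "?J \<in> borel_measurable borel"
    by (rule ennreal_on_pos_measurable[OF over_id_scaled_measurable[OF a]])
  have hl: "hl_max H \<in> borel_measurable lebesgue" for H :: "'a \<Rightarrow> ennreal"
    by (intro measurable_completion) simp
  have "(\<integral>\<^sup>+ x. young_ext A (hl_max ?F x) \<partial>lebesgue)
    = (\<integral>\<^sup>+ t. ennreal_on_pos a t * emeasure lebesgue {x. ennreal t < hl_max ?F x} \<partial>lborel)"
    by (rule young_ext_nn_integral[of a A, OF a A hl])
  also have "\<dots> \<le> (\<integral>\<^sup>+ t. 5 ^ DIM('a) * (?J t * (\<integral>\<^sup>+ y. 2 * ?F y * indicator {y. ennreal t < 2 * ?F y} y \<partial>lebesgue)) \<partial>lborel)"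
  proof (rule nn_integral_mono)
    fix t :: real
    show "ennreal_on_pos a t * emeasure lebesgue {x. ennreal t < hl_max ?F x}
      \<le> 5 ^ DIM('a) * (?J t * (\<integral>\<^sup>+ y. 2 * ?F y * indicator {y. ennreal t < 2 * ?F y} y \<partial>lebesgue))"
    proof (cases "t > 0")
      case False
      then show ?thesis by (simp add: ennreal_on_pos_def)
    next
      case True
      \<comment> \<open>With the cut at t/2, twice \<open>?H\<close> is 2F restricted to the set
        where 2F > t. Everything is then expressed through 2F, and multiplying the weak type
        estimate at height t/2 by 2 a(t)/t restores the factor a(t).\<close>
      let ?H = "\<lambda>y. ?F y * indicator {y. ennreal (t/2) < ?F y} y"
      have lvl: "ennreal (t/2) < ?F y \<longleftrightarrow> ennreal t < 2 * ?F y" for y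
      proof -
        have "2 * ?F y = ennreal (2 * f y)"
          using f0[of y] by (simp add: ennreal_mult'')
        then show ?thesis using True f0[of y] by (simp add: ennreal_less_iff mult.commute)
      qed
      have "{y \<in> space lebesgue. ennreal (t/2) < ?F y} \<in> sets lebesgue" by measurable
      then have [measurable]: "{y. ennreal (t/2) < ?F y} \<in> sets lebesgue" by simp
      have Hm: "?H \<in> borel_measurable lebesgue" by measurable
      have sub: "{x. ennreal t < hl_max ?F x} \<subseteq> {x. ennreal (t/2) < hl_max ?H x}"
      proof (rule Collect_mono, rule impI, rule ccontr)
        fix x assume x: "ennreal t < hl_max ?F x" "\<not> ennreal (t/2) < hl_max ?H x"
        have "hl_max ?F x \<le> ennreal (t/2) + hl_max ?H x"
          by (rule hl_max_split) measurable
        also have "\<dots> \<le> ennreal (t/2) + ennreal (t/2)"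
          using x(2) by (intro add_left_mono) (simp only: not_less)
        also have "\<dots> = ennreal t"
          using True by (subst ennreal_plus[symmetric]) auto
        finally show False using x(1) by (meson leD)
      qed
      have "emeasure lebesgue {x. ennreal t < hl_max ?F x} \<le> emeasure lebesgue {x. ennreal (t/2) < hl_max ?H x}"
        by (rule emeasure_mono[OF sub]) (simp add: borel_open open_hl_max_superlevel)
      then have "ennreal (t/2) * emeasure lebesgue {x. ennreal t < hl_max ?F x} \<le> 5 ^ DIM('a) * (\<integral>\<^sup>+ y. ?H y \<partial>lebesgue)"
        using True by (intro order_trans[OF mult_left_mono hl_max_weak_type[OF Hm]]) auto
      then have "ennreal (2 * (a t / t)) * (ennreal (t/2) * emeasure lebesgue {x. ennreal t < hl_max ?F x})
        \<le> ennreal (2 * (a t / t)) * (5 ^ DIM('a) * (\<integral>\<^sup>+ y. ?H y \<partial>lebesgue))"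
        by (rule mult_left_mono) simp
      moreover have "ennreal (2 * (a t / t)) * (ennreal (t/2) * emeasure lebesgue {x. ennreal t < hl_max ?F x})
        = ennreal_on_pos a t * emeasure lebesgue {x. ennreal t < hl_max ?F x}"
      proof -
        have "ennreal (2 * (a t / t)) * ennreal (t/2) = ennreal (a t)"
          using True young_density_pos[OF a True] by (subst ennreal_mult[symmetric]) auto
        then show ?thesis using True by (simp add: ennreal_on_pos_def mult.assoc[symmetric] del: emeasure_completion)
      qed
      moreover have "ennreal (2 * (a t / t)) * (5 ^ DIM('a) * (\<integral>\<^sup>+ y. ?H y \<partial>lebesgue))
        = 5 ^ DIM('a) * (?J t * (\<integral>\<^sup>+ y. 2 * ?F y * indicator {y. ennreal t < 2 * ?F y} y \<partial>lebesgue))"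
      proof -
        have "ennreal (2 * q) = ennreal q * 2" if "q \<ge> 0" for q
          using that by (simp add: ennreal_mult mult.commute)
        from this[of "a t / t"] have 1: "ennreal (2 * (a t / t)) = ?J t * 2"
          using True young_density_pos[OF a True] by (simp add: ennreal_on_pos_def)
        have 2: "2 * (\<integral>\<^sup>+ y. ?H y \<partial>lebesgue) = (\<integral>\<^sup>+ y. 2 * ?F y * indicator {y. ennreal t < 2 * ?F y} y \<partial>lebesgue)"
          unfolding lvl[symmetric] mult.assoc by (rule nn_integral_cmult[symmetric]) measurable
        show ?thesis unfolding 1 2[symmetric] by (simp only: mult_ac)
      qed
      ultimately show ?thesis by simp
    qed
  qed
  also have "\<dots> = 5 ^ DIM('a) * (\<integral>\<^sup>+ t. ?J t * (\<integral>\<^sup>+ y. 2 * ?F y * indicator {y. ennreal t < 2 * ?F y} y \<partial>lebesgue) \<partial>lborel)"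
  proof (rule nn_integral_cmult)
    interpret sigma_finite_measure "lebesgue :: 'a measure" by (rule sigma_finite_lebesgue)
    show "(\<lambda>t. ?J t * (\<integral>\<^sup>+ y. 2 * ?F y * indicator {y. ennreal t < 2 * ?F y} y \<partial>lebesgue)) \<in> borel_measurable lborel"
      unfolding indicator_def mem_Collect_eq by measurable
  qed
  also have "(\<integral>\<^sup>+ t. ?J t * (\<integral>\<^sup>+ y. 2 * ?F y * indicator {y. ennreal t < 2 * ?F y} y \<partial>lebesgue) \<partial>lborel)
    = (\<integral>\<^sup>+ y. (\<integral>\<^sup>+ t. ?J t * indicator {t. ennreal t < 2 * ?F y} t \<partial>lborel) * (2 * ?F y) \<partial>lebesgue)"
    \<comment> \<open>Read backwards with both the level function and the weight equal to 2F: the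
      inner integral of a(s)/s below 2F, times 2F, is the value of \<open>calA a\<close> at
      2F.\<close>
    by (rule layer_cake[OF sigma_finite_lebesgue J, symmetric]) measurable
  also have "\<dots> \<le> (\<integral>\<^sup>+ x. ennreal (calA a (2 * f x)) \<partial>lebesgue)"
  proof (rule nn_integral_mono)
    fix y
    have 2: "2 * ?F y = ennreal (2 * f y)" using f0[of y] by (simp add: ennreal_mult'')
    have "(\<integral>\<^sup>+ t. ?J t * indicator {t. ennreal t < 2 * ?F y} t \<partial>lborel) \<le> (\<integral>\<^sup>+ t. ?J t * indicator {..2 * f y} t \<partial>lborel)"
      using f0[of y] unfolding 2
      by (intro nn_integral_mono) (auto simp: ennreal_on_pos_def indicator_def ennreal_less_iff)
    then have "(\<integral>\<^sup>+ t. ?J t * indicator {t. ennreal t < 2 * ?F y} t \<partial>lborel) * (2 * ?F y)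
       \<le> (\<integral>\<^sup>+ t. ?J t * indicator {..2 * f y} t \<partial>lborel) * (2 * ?F y)"
      by (rule mult_right_mono) simp
    also have "\<dots> = ennreal (calA a (2 * f y))"
    proof -
      have "ennreal (calA a (2 * f y)) = ennreal (2 * f y) * (\<integral>\<^sup>+ t. ?J t * indicator {..2 * f y} t \<partial>lborel)"
        by (rule calA_nn_integral[OF a fin]) (use f0[of y] in simp)
      then show ?thesis unfolding 2 by (simp only: mult.commute)
    qed
    finally show "(\<integral>\<^sup>+ t. ?J t * indicator {t. ennreal t < 2 * ?F y} t \<partial>lborel) * (2 * ?F y) \<le> ennreal (calA a (2 * f y))" .
  qed
  finally show ?thesis by (simp add: mult_left_mono)
qed

lemma luxemburg_norm_le:
  assumes "l > 0" "(\<integral>\<^sup>+ x. young_ext A (g x / ennreal l) \<partial>lebesgue) \<le> 1"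
  shows "luxemburg_norm A g \<le> ennreal l"
  unfolding luxemburg_norm_def using assms by (intro Inf_lower) blast

text \<open>A modular implication at every admissible scale compares the two infima. An infinite
  right-hand norm is included: its infimum runs over the empty set and leaves nothing to
  check.\<close>

lemma luxemburg_norm_le_cmult:
  assumes C: "C > 0"
    and "\<And>l. l > 0 \<Longrightarrow> (\<integral>\<^sup>+ x. young_ext B (g x / ennreal l) \<partial>lebesgue) \<le> 1 \<Longrightarrow>
      (\<integral>\<^sup>+ x. young_ext A (h x / ennreal (C * l)) \<partial>lebesgue) \<le> 1"
  shows "luxemburg_norm A h \<le> ennreal C * luxemburg_norm B g"
proof -
  have "luxemburg_norm A h / ennreal C \<le> luxemburg_norm B g"
    unfolding luxemburg_norm_def[of B]
  proof (rule Inf_greatest, clarify)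
    fix l :: real assume l: "0 < l" "(\<integral>\<^sup>+ x. young_ext B (g x / ennreal l) \<partial>lebesgue) \<le> 1"
    have "luxemburg_norm A h \<le> ennreal (C * l)"
      using C l by (intro luxemburg_norm_le assms(2)) auto
    then show "luxemburg_norm A h / ennreal C \<le> ennreal l"
      using C l by (intro divide_le_posI_ennreal) (auto simp: ennreal_mult)
  qed
  then show ?thesis
    using C by (simp add: not_less[symmetric] less_divide_ennreal mult.commute)
qed

lemma maximal_conv_orlicz_bound:
  fixes \<phi> :: "real ^ 'n \<Rightarrow> real" and a A :: "real \<Rightarrow> real"
  assumes psi: "(\<integral>\<^sup>+ x. radial_majorant \<phi> x \<partial>lebesgue) < \<infinity>"
    and a: "young_density a"
    and A: "\<And>t. t \<ge> 0 \<Longrightarrow> A t = young_of a t"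
    and fin: "\<And>t. (\<integral>\<^sup>+ s. ennreal_on_pos (\<lambda>s. a s / s) s * indicator {..t} s \<partial>lborel) < \<infinity>"
  shows "\<exists>C>0. \<forall>f \<in> borel_measurable lebesgue.
          luxemburg_norm A (maximal_conv \<phi> f) \<le> ennreal C * orlicz_norm (calA a) f"
proof -
  let ?N = "DIM(real ^ 'n)"
  obtain K0 where K0: "K0 \<ge> 0" "(\<integral>\<^sup>+ x. radial_majorant \<phi> x \<partial>lebesgue) = ennreal K0"
    using psi by (cases "\<integral>\<^sup>+ x. radial_majorant \<phi> x \<partial>lebesgue" rule: ennreal_cases) auto
  \<comment> \<open>The mass may be 0, while the constant must be positive.\<close>
  define K where "K = K0 + 1"
  have K: "K > 0" "(\<integral>\<^sup>+ x. radial_majorant \<phi> x \<partial>lebesgue) \<le> ennreal K"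
    using K0 by (auto simp: K_def simp del: nn_integral_completion)
  define C where "C = 2 * K * 5 ^ ?N"
  have C: "C > 0" using K by (simp add: C_def)
  show ?thesis
  proof (intro exI[of _ C] conjI ballI C luxemburg_norm_le_cmult)
    fix f :: "real ^ 'n \<Rightarrow> real" and l :: real
    assume f [measurable]: "f \<in> borel_measurable lebesgue" and l: "l > 0"
      and mod: "(\<integral>\<^sup>+ x. young_ext (calA a) (ennreal \<bar>f x\<bar> / ennreal l) \<partial>lebesgue) \<le> 1"
    \<comment> \<open>Chosen so that 2|f|/q = (|f|/l)/5^n: the 2 cancels the one in
      \<open>hl_max_modular_le\<close>, and 5^n remains for \<open>calA_le_scale\<close>. The factor
      K in \<open>C\<close> is spent on the mass of the majorant.\<close>
    define q where "q = 2 * 5 ^ ?N * l"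
    have q: "q > 0" and Cl: "C * l = K * q" using l by (simp_all add: q_def C_def)
    have pt: "maximal_conv \<phi> f x / ennreal (C * l) \<le> hl_max (\<lambda>y. ennreal (\<bar>f y\<bar> / q)) x" for x
    proof -
      have "maximal_conv \<phi> f x \<le> ennreal K * hl_max (\<lambda>y. ennreal \<bar>f y\<bar>) x"
        by (intro order_trans[OF maximal_conv_le_hl_max[OF psi f]] mult_right_mono K) simp
      also have "(\<lambda>y. ennreal \<bar>f y\<bar>) = (\<lambda>y. ennreal q * ennreal (\<bar>f y\<bar> / q))"
        using q by (auto simp: fun_eq_iff ennreal_mult'[symmetric])
      also have "hl_max \<dots> x = ennreal q * hl_max (\<lambda>y. ennreal (\<bar>f y\<bar> / q)) x"
        by (rule hl_max_cmult[symmetric]) measurable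
      finally have "maximal_conv \<phi> f x \<le> ennreal (C * l) * hl_max (\<lambda>y. ennreal (\<bar>f y\<bar> / q)) x"
        using K q by (simp add: Cl ennreal_mult mult.assoc)
      then show ?thesis
        using C l by (intro divide_le_posI_ennreal) auto
    qed
    have "(\<integral>\<^sup>+ x. young_ext A (maximal_conv \<phi> f x / ennreal (C * l)) \<partial>lebesgue)
      \<le> (\<integral>\<^sup>+ x. young_ext A (hl_max (\<lambda>y. ennreal (\<bar>f y\<bar> / q)) x) \<partial>lebesgue)"
      by (intro nn_integral_mono young_ext_mono[of a A, OF a A] pt)
    also have "\<dots> \<le> 5 ^ ?N * (\<integral>\<^sup>+ x. ennreal (calA a (2 * (\<bar>f x\<bar> / q))) \<partial>lebesgue)"
      using q by (intro hl_max_modular_le[of a A, OF a A fin]) auto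
    also have "\<dots> = (\<integral>\<^sup>+ x. 5 ^ ?N * ennreal (calA a ((\<bar>f x\<bar> / l) / 5 ^ ?N)) \<partial>lebesgue)"
    proof -
      have "2 * (\<bar>f x\<bar> / q) = (\<bar>f x\<bar> / l) / 5 ^ ?N" for x
        by (simp add: q_def field_simps)
      \<comment> \<open>Needed to take the factor 5^n under the integral; \<open>calA a\<close> is
        Borel on the closed half-line because it is monotone there.\<close>
      moreover have "(\<lambda>x. ennreal (calA a ((\<bar>f x\<bar> / l) / 5 ^ ?N))) \<in> borel_measurable lebesgue"
      proof -
        have "mono_on {0..} (calA a)"
        proof (rule mono_onI)
          fix s t :: real assume "s \<in> {0..}" "s \<le> t"
          then show "calA a s \<le> calA a t"
            unfolding calA_def
            by (intro mult_mono over_id_LBINT_mono[OF a fin] over_id_LBINT_nonneg[OF a fin]) auto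
        qed
        from borel_measurable_mono_on_fnc[OF this]
        have [measurable]: "(\<lambda>s. indicator {0..} s *\<^sub>R calA a s) \<in> borel_measurable borel"
          by (simp add: borel_measurable_restrict_space_iff)
        have "(\<lambda>x. ennreal (indicator {0..} ((\<bar>f x\<bar> / l) / 5 ^ ?N) *\<^sub>R calA a ((\<bar>f x\<bar> / l) / 5 ^ ?N))) \<in> borel_measurable lebesgue"
          by (intro measurable_compose[of "\<lambda>x. (\<bar>f x\<bar> / l) / 5 ^ ?N" _ borel "\<lambda>s. ennreal (indicator {0..} s *\<^sub>R calA a s)"]) measurable
        then show ?thesis using l by simp
      qed
      ultimately show ?thesis by (simp add: nn_integral_cmult del: nn_integral_completion)
    qed
    also have "\<dots> \<le> (\<integral>\<^sup>+ x. young_ext (calA a) (ennreal \<bar>f x\<bar> / ennreal l) \<partial>lebesgue)"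
    proof (rule nn_integral_mono)
      fix x
      have p: "(5::ennreal) ^ ?N = ennreal (5 ^ ?N)" by (simp add: ennreal_power[symmetric])
      have "ennreal (calA a ((\<bar>f x\<bar> / l) / 5 ^ ?N)) \<le> ennreal (calA a (\<bar>f x\<bar> / l) / 5 ^ ?N)"
        using l by (intro ennreal_leI calA_le_scale[OF a fin]) auto
      then have "5 ^ ?N * ennreal (calA a ((\<bar>f x\<bar> / l) / 5 ^ ?N)) \<le> 5 ^ ?N * ennreal (calA a (\<bar>f x\<bar> / l) / 5 ^ ?N)"
        by (rule mult_left_mono) simp
      also have "\<dots> = ennreal (calA a (\<bar>f x\<bar> / l))"
        unfolding p by (subst ennreal_mult'[symmetric]) simp_all
      also have "\<dots> = young_ext (calA a) (ennreal \<bar>f x\<bar> / ennreal l)"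
        using l by (simp add: young_ext_def divide_ennreal)
      finally show "5 ^ ?N * ennreal (calA a ((\<bar>f x\<bar> / l) / 5 ^ ?N)) \<le> \<dots>" .
    qed
    also note mod
    finally show "(\<integral>\<^sup>+ x. young_ext A (maximal_conv \<phi> f x / ennreal (C * l)) \<partial>lebesgue) \<le> 1" .
  qed
qed

section \<open>Optimality: testing on balls\<close>

text \<open>On [t/2, t] the density is at least a(t/2) > 0. Positivity of B(h) allows a test ball of
  volume 1/B(h).\<close>

lemma young_of_pos:
  assumes a: "young_density a" and t: "t > 0"
  shows "0 < young_of a t"
proof -
  have "0 < ennreal (a (t/2)) * ennreal (t - t/2)"
    using t young_density_pos[OF a, of "t/2"] by (simp add: ennreal_zero_less_mult_iff)
  also have "\<dots> = (\<integral>\<^sup>+ s. ennreal (a (t/2)) * indicator {t/2..t} s \<partial>lborel)"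
    using t by (simp add: nn_integral_cmult)
  also have "\<dots> \<le> (\<integral>\<^sup>+ s. ennreal_on_pos a s * indicator {..t} s \<partial>lborel)"
    using t by (intro nn_integral_mono)
      (auto simp: ennreal_on_pos_def indicator_def intro!: ennreal_leI young_density_mono[OF a])
  also have "\<dots> = ennreal (young_of a t)"
    by (rule young_of_nn_integral[OF a, symmetric])
  finally show ?thesis by simp
qed

lemma radial_decreasing_measurable:
  fixes \<phi> :: "real ^ 'n \<Rightarrow> real"
  assumes "radial_decreasing \<phi>"
  shows "\<phi> \<in> borel_measurable borel"
proof -
  obtain g where g: "antimono_on {0<..} g" "\<And>x. \<phi> x = g (norm x)"
    using assms by (auto simp: radial_decreasing_def)
  have "mono_on {0<..} (\<lambda>s. - g s)"
    using g(1) by (auto simp: monotone_on_def)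
  from borel_measurable_mono_on_fnc[OF this]
  have [measurable]: "(\<lambda>s. indicator {0<..} s *\<^sub>R (- g s)) \<in> borel_measurable borel"
    by (simp add: borel_measurable_restrict_space_iff)
  \<comment> \<open>The origin is split off because monotonicity says nothing about
    \<open>g 0\<close>.\<close>
  have "\<phi> = (\<lambda>x. if x = 0 then g 0 else - (indicator {0<..} (norm x) *\<^sub>R (- g (norm x))))"
    by (auto simp: fun_eq_iff g(2))
  also have "\<dots> \<in> borel_measurable borel"
  proof (rule measurable_If)
    show "(\<lambda>x::real ^ 'n. - (indicator {0<..} (norm x) *\<^sub>R (- g (norm x)))) \<in> borel_measurable borel"
      by (intro borel_measurable_uminus
          measurable_compose[of norm _ borel "\<lambda>s. indicator {0<..} s *\<^sub>R (- g s)"]) measurable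
  qed auto
  finally show ?thesis .
qed

text \<open>Testing at \<open>x\<close> with \<open>\<epsilon> = 2 max(r,|x|)\<close> makes \<open>|x - y|/\<epsilon> \<le> 1\<close> for every \<open>y\<close> in the ball.\<close>

lemma maximal_conv_ball_ge:
  fixes \<phi> :: "real ^ 'n \<Rightarrow> real"
  assumes psi: "(\<integral>\<^sup>+ x. radial_majorant \<phi> x \<partial>lebesgue) < \<infinity>"
    and pos: "\<And>x. \<phi> x > 0" and rd: "radial_decreasing \<phi>"
  shows "\<exists>c>0. \<forall>h>0. \<forall>r>0. \<forall>x. ennreal (c * h * (r / max r (norm x)) ^ CARD('n))
           \<le> maximal_conv \<phi> (\<lambda>y. h * indicator (ball 0 r) y) x"
proof -
  obtain g where anti: "antimono_on {0<..} g" and g: "\<And>x. \<phi> x = g (norm x)"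
    using rd by (auto simp: radial_decreasing_def)
  have phim [measurable]: "\<phi> \<in> borel_measurable borel" by (rule radial_decreasing_measurable[OF rd])
  obtain e :: "real ^ 'n" where "norm e = 1" using vector_choose_size[of 1] by auto
  then have g1: "g 1 > 0" using pos[of e] g[of e] by simp
  define V where "V = unit_ball_vol (real CARD('n))"
  have V: "V > 0" by (simp add: V_def)
  \<comment> \<open>\<open>g 1\<close> bounds the kernel below on the punctured unit ball, V r^n is
    the volume of the test ball, and 2^n comes from the n-th power of \<open>\<epsilon>\<close> =
    2m.\<close>
  define c where "c = g 1 * V / 2 ^ CARD('n)"
  have c: "c > 0" using g1 V by (simp add: c_def)
  show ?thesis
  proof (intro exI[of _ c] conjI allI impI c)
    fix h r :: real and x :: "real ^ 'n"
    assume h: "h > 0" and r: "r > 0"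
    let ?f = "\<lambda>y::real ^ 'n. h * indicator (ball 0 r) y :: real"
    define m where "m = max r (norm x)"
    have m: "m > 0" "r \<le> m" "norm x \<le> m" using r by (auto simp: m_def)
    define \<epsilon> where "\<epsilon> = 2 * m"
    have \<epsilon>: "\<epsilon> > 0" using m by (simp add: \<epsilon>_def)
    have [measurable]: "ball (0 :: real ^ 'n) r \<in> sets borel" by simp
    have fm [measurable]: "?f \<in> borel_measurable borel" by measurable
    then have fl: "?f \<in> borel_measurable lebesgue" by (intro measurable_completion) simp
    have f0: "?f y \<ge> 0" for y using h by (simp add: indicator_def)
    have d0: "dilate \<phi> \<epsilon> z \<ge> 0" for z
      using \<epsilon> pos[of "inverse \<epsilon> *\<^sub>R z"] by (simp add: dilate_def)
    have "(\<lambda>y. dilate \<phi> \<epsilon> (x - y) * ?f y) \<in> borel_measurable lborel"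
      unfolding dilate_def by measurable
    then have meas: "(\<lambda>y. dilate \<phi> \<epsilon> (x - y) * ?f y) \<in> borel_measurable lebesgue"
      by (rule measurable_completion)
    have "(\<integral>\<^sup>+ y. ennreal (dilate \<phi> \<epsilon> (x - y) * ?f y) \<partial>lebesgue)
       = (\<integral>\<^sup>+ y. ennreal \<bar>dilate \<phi> \<epsilon> (x - y) * ?f y\<bar> \<partial>lebesgue)"
      by (simp only: abs_of_nonneg[OF mult_nonneg_nonneg[OF d0 f0]])
    also have "\<dots> \<le> (\<integral>\<^sup>+ x. radial_majorant \<phi> x \<partial>lebesgue) * hl_max (\<lambda>y. ennreal \<bar>?f y\<bar>) x"
      by (rule nn_integral_dilate_le_hl_max[OF psi fl \<epsilon>])
    also have "\<dots> \<le> (\<integral>\<^sup>+ x. radial_majorant \<phi> x \<partial>lebesgue) * ennreal h"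
      using h by (intro mult_left_mono hl_max_bounded) (auto simp: indicator_def)
    also have "\<dots> < \<infinity>"
      using psi by (simp add: ennreal_mult_less_top del: nn_integral_completion)
    \<comment> \<open>Without integrability \<open>convolve\<close> would be 0 and no lower bound
      could hold. The test function is bounded by h, hence so is its maximal function.\<close>
    finally have int: "integrable lebesgue (\<lambda>y. dilate \<phi> \<epsilon> (x - y) * ?f y)"
      using d0 f0 by (intro integrableI_nonneg meas) (auto simp del: nn_integral_completion)
    have conv0: "convolve (dilate \<phi> \<epsilon>) ?f x \<ge> 0"
      unfolding convolve_def using d0 f0 by (intro integral_nonneg_AE) auto
    \<comment> \<open>At y = x the kernel is evaluated at the origin, where its value need not be at
      least \<open>g 1\<close>; this single point is discarded as a null set.\<close>
    have lower: "ennreal (inverse (\<epsilon> ^ CARD('n)) * g 1 * h) * indicator (ball 0 r) y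
        \<le> ennreal (dilate \<phi> \<epsilon> (x - y) * ?f y)" if "y \<noteq> x" for y
    proof (cases "y \<in> ball 0 r")
      case True
      have "norm (x - y) \<le> norm x + norm y" by (rule norm_triangle_ineq4)
      also have "\<dots> \<le> \<epsilon>" using m True by (simp add: \<epsilon>_def)
      finally have "norm (x - y) / \<epsilon> \<le> 1" using \<epsilon> by simp
      then have "norm (inverse \<epsilon> *\<^sub>R (x - y)) \<le> 1"
        using \<epsilon> by (simp add: divide_inverse mult.commute del: scaleR_diff_right)
      moreover have "norm (inverse \<epsilon> *\<^sub>R (x - y)) > 0" using \<epsilon> that by simp
      ultimately have "g 1 \<le> \<phi> (inverse \<epsilon> *\<^sub>R (x - y))"
        using anti unfolding g monotone_on_def by auto
      then have "inverse (\<epsilon> ^ CARD('n)) * g 1 * h \<le> inverse (\<epsilon> ^ CARD('n)) * \<phi> (inverse \<epsilon> *\<^sub>R (x - y)) * h"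
        using \<epsilon> h by (intro mult_right_mono mult_left_mono) auto
      then show ?thesis using True by (simp add: dilate_def ennreal_leI del: scaleR_diff_right)
    qed simp
    have "ennreal (c * h * (r / m) ^ CARD('n)) = ennreal (inverse (\<epsilon> ^ CARD('n)) * g 1 * h) * ennreal (V * r ^ CARD('n))"
      using \<epsilon> g1 h V r m
      by (subst ennreal_mult[symmetric]) (auto simp: c_def \<epsilon>_def field_simps power_mult_distrib power_divide)
    also have "\<dots> = ennreal (inverse (\<epsilon> ^ CARD('n)) * g 1 * h) * emeasure lebesgue (ball (0 :: real ^ 'n) r)"
      using r by (subst emeasure_lebesgue_ball) (auto simp: V_def)
    also have "\<dots> = (\<integral>\<^sup>+ y. ennreal (inverse (\<epsilon> ^ CARD('n)) * g 1 * h) * indicator (ball 0 r) y \<partial>(lebesgue :: (real ^ 'n) measure))"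
      by (subst nn_integral_cmult_indicator) auto
    also have "\<dots> \<le> (\<integral>\<^sup>+ y. ennreal (dilate \<phi> \<epsilon> (x - y) * ?f y) \<partial>lebesgue)"
    proof (rule nn_integral_mono_AE)
      have "AE y in lborel. y \<noteq> x" by (rule AE_lborel_singleton)
      then show "AE y in lebesgue. ennreal (inverse (\<epsilon> ^ CARD('n)) * g 1 * h) * indicator (ball 0 r) y
        \<le> ennreal (dilate \<phi> \<epsilon> (x - y) * ?f y)"
        by (intro AE_completion) (elim eventually_mono, rule lower)
    qed
    also have "\<dots> = ennreal (convolve (dilate \<phi> \<epsilon>) ?f x)"
      unfolding convolve_def using d0 f0 by (intro nn_integral_eq_integral int) auto
    also have "\<dots> \<le> maximal_conv \<phi> ?f x"
      unfolding maximal_conv_def using \<epsilon> conv0 by (intro SUP_upper2[of \<epsilon>]) auto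
    finally show "ennreal (c * h * (r / max r (norm x)) ^ CARD('n)) \<le> maximal_conv \<phi> ?f x"
      by (simp only: m_def)
  qed
qed

text \<open>The superlevel set at height \<open>t < d\<close> contains the ball of measure \<open>|B\<^sub>r| d / t\<close>.\<close>

lemma calA_le_modular_profile:
  fixes a A :: "real \<Rightarrow> real" and G :: "real ^ 'n \<Rightarrow> ennreal"
  assumes a: "young_density a" and A: "\<And>t. t \<ge> 0 \<Longrightarrow> A t = young_of a t"
    and fin: "\<And>t. (\<integral>\<^sup>+ s. ennreal_on_pos (\<lambda>s. a s / s) s * indicator {..t} s \<partial>lborel) < \<infinity>"
    and d: "d > 0" and r: "r > 0"
    and G: "\<And>x. ennreal (d * (r / max r (norm x)) ^ CARD('n)) \<le> G x"
  shows "emeasure lebesgue (ball (0 :: real ^ 'n) r) * ennreal (calA a d) \<le> (\<integral>\<^sup>+ x. young_ext A (G x) \<partial>lebesgue)"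
proof -
  let ?n = "CARD('n)" and ?J = "ennreal_on_pos (\<lambda>s. a s / s)"
  let ?P = "\<lambda>x::real ^ 'n. ennreal (d * (r / max r (norm x)) ^ ?n)"
  let ?v = "emeasure lebesgue (ball (0 :: real ^ 'n) r)"
  have J [measurable]: "?J \<in> borel_measurable borel"
    by (rule ennreal_on_pos_measurable[OF over_id_scaled_measurable[OF a]])
  have "?P \<in> borel_measurable lborel" by measurable
  then have P: "?P \<in> borel_measurable lebesgue" by (rule measurable_completion)
  have Pset: "{x. ennreal t < ?P x} \<in> sets lebesgue" for t
  proof -
    have "{x \<in> space lebesgue. ennreal t < ?P x} \<in> sets lebesgue" using P by measurable
    then show ?thesis by simp
  qed
  have "?v * ennreal (calA a d) = (?v * ennreal d) * (\<integral>\<^sup>+ s. ?J s * indicator {..d} s \<partial>lborel)"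
    using d by (simp only: calA_nn_integral[OF a fin, of d] less_imp_le mult.assoc)
  also have "\<dots> = (\<integral>\<^sup>+ s. (?v * ennreal d) * (?J s * indicator {..d} s) \<partial>lborel)"
    by (rule nn_integral_cmult[symmetric]) measurable
  also have "\<dots> \<le> (\<integral>\<^sup>+ t. ennreal_on_pos a t * emeasure lebesgue {x. ennreal t < ?P x} \<partial>lborel)"
  \<comment> \<open>At t = d the inequality can fail: the left integrand still counts this level,
    while the profile never exceeds d.\<close>
  proof (intro nn_integral_mono_AE eventually_mono[OF AE_lborel_singleton[of d]])
    fix t :: real assume "t \<noteq> d"
    show "(?v * ennreal d) * (?J t * indicator {..d} t) \<le> ennreal_on_pos a t * emeasure lebesgue {x. ennreal t < ?P x}"
    proof (cases "0 < t \<and> t < d")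
      case False
      then have "t \<le> 0 \<or> t > d" using \<open>t \<noteq> d\<close> by linarith
      then show ?thesis by (auto simp: ennreal_on_pos_def)
    next
      case True
      then have t: "0 < t" "t < d" by auto
      \<comment> \<open>Since k > 1, \<open>max r (norm x)\<close> < k r holds on the whole ball of
        radius k r, so the profile there exceeds d / k^n = t.\<close>
      define k where "k = root ?n (d / t)"
      have k: "k > 0" "k ^ ?n = d / t" "k > 1"
        using t by (auto simp: k_def)
      have "ball 0 (k * r) \<subseteq> {x. ennreal t < ?P x}"
      proof
        fix x :: "real ^ 'n" assume "x \<in> ball 0 (k * r)"
        then have "max r (norm x) < k * r" using k(3) r by simp
        then have "max r (norm x) ^ ?n < (k * r) ^ ?n"
          using r by (intro power_strict_mono) auto
        then have "t * max r (norm x) ^ ?n < d * r ^ ?n"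
          using t by (simp add: power_mult_distrib k(2) field_simps)
        then have "t < d * (r / max r (norm x)) ^ ?n"
          using r by (simp add: power_divide field_simps)
        then show "x \<in> {x. ennreal t < ?P x}"
          using t by (simp only: mem_Collect_eq ennreal_less_iff less_imp_le)
      qed
      then have "emeasure lebesgue (ball (0 :: real ^ 'n) (k * r)) \<le> emeasure lebesgue {x. ennreal t < ?P x}"
        by (rule emeasure_mono[OF _ Pset])
      then have "ennreal (d / t) * ?v \<le> emeasure lebesgue {x. ennreal t < ?P x}"
        using emeasure_lebesgue_ball_scale[of r k "0 :: real ^ 'n" 0] r k by (simp only: less_imp_le DIM_cart) simp
      then have "ennreal (a t) * (ennreal (d / t) * ?v) \<le> ennreal (a t) * emeasure lebesgue {x. ennreal t < ?P x}"
        by (rule mult_left_mono) simp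
      moreover have "(?v * ennreal d) * (?J t * indicator {..d} t) = ennreal (a t) * (ennreal (d / t) * ?v)"
      proof -
        have "ennreal d * ennreal (a t / t) = ennreal (a t) * ennreal (d / t)"
          using d t young_density_pos[OF a t(1)] by (simp add: ennreal_mult[symmetric] mult.commute)
        then have "?v * (ennreal d * ennreal (a t / t)) = ennreal (a t) * (ennreal (d / t) * ?v)"
          by (simp only: mult_ac)
        then show ?thesis
          using t by (simp add: ennreal_on_pos_def mult.assoc del: emeasure_completion)
      qed
      ultimately show ?thesis
        using t by (simp add: ennreal_on_pos_def del: emeasure_completion)
    qed
  qed
  also have "\<dots> = (\<integral>\<^sup>+ x. young_ext A (?P x) \<partial>lebesgue)"
    by (rule young_ext_nn_integral[of a A, OF a A P, symmetric])
  also have "\<dots> \<le> (\<integral>\<^sup>+ x. young_ext A (G x) \<partial>lebesgue)"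
    by (intro nn_integral_mono young_ext_mono[of a A, OF a A G])
  finally show ?thesis .
qed

text \<open>Strictness provides an admissible scale below L, so attainment of the infimum is not an
  issue; the modular only decreases as the scale grows.\<close>

lemma luxemburg_normD:
  assumes a: "young_density a" and A: "\<And>t. t \<ge> 0 \<Longrightarrow> A t = young_of a t"
    and "luxemburg_norm A g < ennreal L"
  shows "(\<integral>\<^sup>+ x. young_ext A (g x / ennreal L) \<partial>lebesgue) \<le> 1"
proof -
  obtain l where l: "l > 0" "ennreal l < ennreal L" "(\<integral>\<^sup>+ x. young_ext A (g x / ennreal l) \<partial>lebesgue) \<le> 1"
    using assms(3) unfolding luxemburg_norm_def Inf_less_iff by blast
  have "g x / ennreal L \<le> g x / ennreal l" for x
    using l by (auto simp: ennreal_less_iff divide_ennreal_def inverse_ennreal intro!: mult_left_mono ennreal_leI)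
  then have "(\<integral>\<^sup>+ x. young_ext A (g x / ennreal L) \<partial>lebesgue) \<le> (\<integral>\<^sup>+ x. young_ext A (g x / ennreal l) \<partial>lebesgue)"
    by (intro nn_integral_mono young_ext_mono[of a A, OF a A])
  then show ?thesis using l(3) by (rule order_trans)
qed

text \<open>The constant c from \<open>maximal_conv_ball_ge\<close> is uniform in height and radius,
  so the radius may depend on h while a single \<open>\<kappa>\<close> = c/L serves all
  heights.\<close>

lemma calA_le_of_maximal_bound:
  fixes \<phi> :: "real ^ 'n \<Rightarrow> real" and a A B :: "real \<Rightarrow> real"
  assumes psi: "(\<integral>\<^sup>+ x. radial_majorant \<phi> x \<partial>lebesgue) < \<infinity>"
    and a: "young_density a" and A: "\<And>t. t \<ge> 0 \<Longrightarrow> A t = young_of a t"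
    and fin: "\<And>t. (\<integral>\<^sup>+ s. ennreal_on_pos (\<lambda>s. a s / s) s * indicator {..t} s \<partial>lborel) < \<infinity>"
    and pos: "\<And>x. \<phi> x > 0" and rd: "radial_decreasing \<phi>"
    and B: "is_young B" and C': "C' > 0"
    and bound: "\<And>f. f \<in> orlicz_space B \<Longrightarrow> luxemburg_norm A (maximal_conv \<phi> f) \<le> ennreal C' * orlicz_norm B f"
  shows "\<exists>\<kappa>>0. \<forall>h>0. calA a (\<kappa> * h) \<le> B h"
proof -
  obtain b where b: "young_density b" and Bb: "\<And>t. t \<ge> 0 \<Longrightarrow> B t = young_of b t"
    using B by (auto simp: is_young_def)
  obtain c where c: "c > 0" and lower: "\<And>h r x. h > 0 \<Longrightarrow> r > 0 \<Longrightarrow>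
      ennreal (c * h * (r / max r (norm x)) ^ CARD('n)) \<le> maximal_conv \<phi> (\<lambda>y. h * indicator (ball 0 r) y) x"
    using maximal_conv_ball_ge[OF psi pos rd] by blast
  \<comment> \<open>Strictly larger than C', so that a norm of at most C' lies below L and
    \<open>luxemburg_normD\<close> applies.\<close>
  define L where "L = C' + 1"
  have L: "L > 0" using C' by (simp add: L_def)
  have "calA a (c / L * h) \<le> B h" if h: "h > 0" for h
  proof -
    have Bh: "B h > 0" using Bb[of h] young_of_pos[OF b h] h by simp
    define V where "V = unit_ball_vol (real CARD('n))"
    have V: "V > 0" by (simp add: V_def)
    define r where "r = root CARD('n) (1 / (V * B h))"
    have r: "r > 0" using V Bh by (simp add: r_def)
    have "r ^ CARD('n) = 1 / (V * B h)"
      using V Bh by (simp add: r_def real_root_pow_pos2)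
    then have vol: "emeasure lebesgue (ball (0 :: real ^ 'n) r) = ennreal (1 / B h)"
      using r V by (simp add: emeasure_lebesgue_ball V_def[symmetric] del: emeasure_completion)
    let ?f = "\<lambda>y::real ^ 'n. h * indicator (ball 0 r) y :: real"
    have [measurable]: "ball (0 :: real ^ 'n) r \<in> sets borel" by simp
    have "?f \<in> borel_measurable lborel" by measurable
    then have fl: "?f \<in> borel_measurable lebesgue" by (rule measurable_completion)
    have [simp]: "z / 1 = z" for z :: ennreal by (simp add: divide_ennreal_def)
    have "(\<integral>\<^sup>+ y. young_ext B (ennreal \<bar>?f y\<bar> / ennreal 1) \<partial>lebesgue)
      = (\<integral>\<^sup>+ y. ennreal (B h) * indicator (ball 0 r) y \<partial>(lebesgue :: (real ^ 'n) measure))"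
      using h Bb[of 0] by (intro nn_integral_cong) (auto simp: young_ext_def indicator_def divide_ennreal)
    also have "\<dots> = ennreal (B h) * emeasure lebesgue (ball (0 :: real ^ 'n) r)"
      by (rule nn_integral_cmult_indicator) simp
    also have "\<dots> = 1" unfolding vol using Bh by (subst ennreal_mult[symmetric]) auto
    finally have norm1: "orlicz_norm B ?f \<le> 1"
      using luxemburg_norm_le[of 1 B "\<lambda>y. ennreal \<bar>?f y\<bar>"] by simp
    then have "?f \<in> orlicz_space B"
      using fl by (auto simp: orlicz_space_def intro: le_less_trans)
    then have "luxemburg_norm A (maximal_conv \<phi> ?f) \<le> ennreal C' * 1"
      using norm1 by (intro order_trans[OF bound] mult_left_mono) auto
    also have "\<dots> < ennreal L" using C' by (simp add: L_def ennreal_lessI)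
    finally have lt: "luxemburg_norm A (maximal_conv \<phi> ?f) < ennreal L" .
    have "(\<integral>\<^sup>+ x. young_ext A (maximal_conv \<phi> ?f x / ennreal L) \<partial>lebesgue) \<le> 1"
      by (rule luxemburg_normD[OF a _ lt]) (rule A)
    moreover have "ennreal (c / L * h * (r / max r (norm x)) ^ CARD('n)) \<le> maximal_conv \<phi> ?f x / ennreal L" for x
    proof -
      have "ennreal (c / L * h * (r / max r (norm x)) ^ CARD('n)) = ennreal (c * h * (r / max r (norm x)) ^ CARD('n)) / ennreal L"
        using c L h r by (subst divide_ennreal) (auto simp: less_max_iff_disj)
      also have "\<dots> \<le> maximal_conv \<phi> ?f x / ennreal L"
        by (rule divide_right_mono_ennreal[OF lower[OF h r]])
      finally show ?thesis .
    qed
    then have "emeasure lebesgue (ball (0 :: real ^ 'n) r) * ennreal (calA a (c / L * h))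
      \<le> (\<integral>\<^sup>+ x. young_ext A (maximal_conv \<phi> ?f x / ennreal L) \<partial>lebesgue)"
      using c L h by (intro calA_le_modular_profile[of a A, OF a A fin _ r]) auto
    ultimately have "ennreal (1 / B h) * ennreal (calA a (c / L * h)) \<le> 1"
      unfolding vol by (rule order_trans[rotated])
    then have "ennreal (1 / B h * calA a (c / L * h)) \<le> ennreal 1"
      using Bh by (subst ennreal_mult') auto
    then have "1 / B h * calA a (c / L * h) \<le> 1"
      by (subst (asm) ennreal_le_iff) auto
    then show ?thesis using Bh by (simp add: field_simps)
  qed
  then show ?thesis using c L by (intro exI[of _ "c / L"]) auto
qed

text \<open>Replacing the scale l by l/\<open>\<kappa>\<close> turns the inequality at h = |f|/l
  into a comparison of modulars. It is given for h > 0 only, so zeros of f are covered by A 0 =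
  0.\<close>

lemma orlicz_space_mono:
  assumes "\<kappa> > 0" and le: "\<And>h. h > 0 \<Longrightarrow> A (\<kappa> * h) \<le> B h" and A0: "A 0 = 0"
  shows "orlicz_space B \<subseteq> orlicz_space A"
proof
  fix f :: "real ^ 'n \<Rightarrow> real" assume "f \<in> orlicz_space B"
  then have f: "f \<in> borel_measurable lebesgue" and "orlicz_norm B f < \<infinity>"
    by (auto simp: orlicz_space_def)
  then obtain l where l: "l > 0" "(\<integral>\<^sup>+ x. young_ext B (ennreal \<bar>f x\<bar> / ennreal l) \<partial>lebesgue) \<le> 1"
    unfolding luxemburg_norm_def Inf_less_iff by blast
  have "(\<integral>\<^sup>+ x. young_ext A (ennreal \<bar>f x\<bar> / ennreal (l / \<kappa>)) \<partial>lebesgue)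
    \<le> (\<integral>\<^sup>+ x. young_ext B (ennreal \<bar>f x\<bar> / ennreal l) \<partial>lebesgue)"
  proof (rule nn_integral_mono)
    fix x
    have "A (\<bar>f x\<bar> / (l / \<kappa>)) \<le> B (\<bar>f x\<bar> / l)" if "f x \<noteq> 0"
      using le[of "\<bar>f x\<bar> / l"] that l by (simp add: mult.commute)
    then show "young_ext A (ennreal \<bar>f x\<bar> / ennreal (l / \<kappa>)) \<le> young_ext B (ennreal \<bar>f x\<bar> / ennreal l)"
      using l assms(1) A0 by (cases "f x = 0") (auto simp: young_ext_def divide_ennreal intro: ennreal_leI)
  qed
  then have "orlicz_norm A f \<le> ennreal (l / \<kappa>)"
    using l assms(1) by (intro luxemburg_norm_le) auto
  then show "f \<in> orlicz_space A"
    using f by (auto simp: orlicz_space_def intro: le_less_trans)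
qed

theorem theorem4p3:
  fixes \<phi> :: "real ^ 'n \<Rightarrow> real" and a A :: "real \<Rightarrow> real"
  assumes phi_int: "integrable lebesgue \<phi>"
    and psi_int: "(\<integral>\<^sup>+ x. radial_majorant \<phi> x \<partial>lebesgue) < \<infinity>"
    and a: "young_density a"
    and A: "\<And>t. t \<ge> 0 \<Longrightarrow> A t = young_of a t"
    and A_int: "\<exists>k>0. (\<integral>\<^sup>+ t\<in>{0<..}. ennreal (A (k / (1 + t))) \<partial>lborel) < \<infinity>"
  shows "is_young (calA a)
    \<and> (\<exists>C>0. \<forall>f \<in> borel_measurable lebesgue. orlicz_norm (calA a) f < \<infinity> \<longrightarrow>
          luxemburg_norm A (maximal_conv \<phi> f) \<le> ennreal C * orlicz_norm (calA a) f)
    \<and> ((\<forall>x. \<phi> x > 0) \<and> radial_decreasing \<phi> \<longrightarrow>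
        (\<forall>B. is_young B \<and>
            (\<exists>C'>0. \<forall>f \<in> orlicz_space B.
                luxemburg_norm A (maximal_conv \<phi> f) \<le> ennreal C' * orlicz_norm B f) \<longrightarrow>
          (orlicz_space B :: (real ^ 'n \<Rightarrow> real) set) \<subseteq> orlicz_space (calA a)))"
proof (intro conjI impI allI)
  \<comment> \<open>The growth hypothesis on A enters in this form: finiteness for every t is what
    the lemmas on \<open>calA\<close> take as a premise.\<close>
  have fin: "(\<integral>\<^sup>+ s. ennreal_on_pos (\<lambda>s. a s / s) s * indicator {..t} s \<partial>lborel) < \<infinity>" for t
    by (rule young_density_over_id_integrable[of a A, OF a A A_int])
  show "is_young (calA a)"
    unfolding is_young_def using young_density_calA[OF a fin] calA_eq_young_of[OF a fin] by blast
  show "\<exists>C>0. \<forall>f \<in> borel_measurable lebesgue. orlicz_norm (calA a) f < \<infinity> \<longrightarrow>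
          luxemburg_norm A (maximal_conv \<phi> f) \<le> ennreal C * orlicz_norm (calA a) f"
    using maximal_conv_orlicz_bound[of \<phi> a A, OF psi_int a A fin] by blast
  fix B
  assume phi: "(\<forall>x. \<phi> x > 0) \<and> radial_decreasing \<phi>"
    and B: "is_young B \<and> (\<exists>C'>0. \<forall>f \<in> orlicz_space B.
                luxemburg_norm A (maximal_conv \<phi> f) \<le> ennreal C' * orlicz_norm B f)"
  then obtain C' where C': "C' > 0" "\<And>f. f \<in> orlicz_space B \<Longrightarrow>
      luxemburg_norm A (maximal_conv \<phi> f) \<le> ennreal C' * orlicz_norm B f" by blast
  obtain \<kappa> where "\<kappa> > 0" "\<And>h. h > 0 \<Longrightarrow> calA a (\<kappa> * h) \<le> B h"
    using calA_le_of_maximal_bound[of \<phi> a A B C', OF psi_int a A fin _ _ _ C'] phi B by blast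
  then show "(orlicz_space B :: (real ^ 'n \<Rightarrow> real) set) \<subseteq> orlicz_space (calA a)"
    by (rule orlicz_space_mono) (simp_all add: calA_def)
qed

end
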